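(* For every $\sigma\in(0,1)$ and every $x>0$, $$\phi(\sigma,0;x)=\sqrt{x}\int_0^\infty\phi(-\sigma,0;-s)\,s^{-1/2}\,I_1(2\sqrt{xs})\,ds$$ and $$\phi(-\sigma,0;-x)=-\sqrt{x}\int_0^\infty\phi(\sigma,0;-s)\,s^{-1/2}\,J_1(2\sqrt{xs})\,ds .$$
   Context: For real $\rho\in(-1,0)\cup(0,\infty)$ and real $z$, the reduced Wright function is $\phi(\rho,0;z)=\sum_{n=1}^\infty \frac{z^n}{n!\,\Gamma(\rho n)}$, where $1/\Gamma$ is the entire reciprocal gamma function (equal to $0$ at $0,-1,-2,\ldots$). $J_1$ is the Bessel function of the first kind and $I_1$ the modified Bessel function of the first kind, both of order $1$. *)

theory Defs
  imports "HOL-Analysis.Analysis"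
begin

text \<open>
  The reduced Wright function \<open>\<phi>(\<rho>, 0; z)\<close>, meant for \<open>\<rho> > -1\<close>, \<open>\<rho> \<noteq> 0\<close>, where the series
  converges for every real \<open>z\<close>. The summation index of the usual series starts at 1, hence the shift.
  \<^const>\<open>rGamma\<close> is the entire reciprocal Gamma function, which vanishes at the nonpositive integers.
\<close>
definition reduced_wright :: "real \<Rightarrow> real \<Rightarrow> real" where
  "reduced_wright \<rho> z = (\<Sum>n. z ^ Suc n / fact (Suc n) * rGamma (\<rho> * real (Suc n)))"

definition bessel_J :: "nat \<Rightarrow> real \<Rightarrow> real" where
  "bessel_J m x = (\<Sum>k. (-1) ^ k / (fact k * fact (k + m)) * (x / 2) ^ (2 * k + m))"

definition bessel_I :: "nat \<Rightarrow> real \<Rightarrow> real" where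
  "bessel_I m x = (\<Sum>k. 1 / (fact k * fact (k + m)) * (x / 2) ^ (2 * k + m))"

end

theory Submission
  imports Defs "HOL-Complex_Analysis.Complex_Analysis"
begin

text \<open>
  By Hankel's formula \<open>1 / \<Gamma>(w) = (2 \<pi> i)\<^sup>-\<^sup>1 \<integral> e\<^sup>u u\<^bsup>-w\<^esup> du\<close>, summing the series gives
  \<open>\<phi>(\<rho>, 0; z) = (2 \<pi> i)\<^sup>-\<^sup>1 \<integral> e\<^sup>u exp (z u\<^bsup>-\<rho>\<^esup>) du\<close> for \<open>\<bar>\<rho>\<bar> < 1\<close>. With
  \<open>B(z, s) = \<Sum>\<^sub>k z\<^bsup>k+1\<^esup> s\<^sup>k / (k! (k+1)!)\<close> one has
  \<open>\<integral>\<^sub>0\<^sup>\<infinity> e\<^bsup>-v s\<^esup> B(z, s) ds = e\<^bsup>z/v\<^esup> - 1\<close> for \<open>Re v > 0\<close>. Taking \<open>v = u\<^bsup>-\<rho>\<^esup>\<close>, which has positive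
  real part on a Hankel contour of suitable opening angle, and exchanging the integrals yields
  \<open>\<integral>\<^sub>0\<^sup>\<infinity> \<phi>(\<rho>, 0; -s) B(z, s) ds = \<phi>(-\<rho>, 0; z)\<close>. Both identities are instances, since
  \<open>B(x, s)\<close> and \<open>- B(-x, s)\<close> are \<open>(x / s)\<^bsup>1/2\<^esup>\<close> times \<open>I\<^sub>1\<close> and \<open>J\<^sub>1\<close> at \<open>2 (x s)\<^bsup>1/2\<^esup>\<close>.
\<close>

subsection \<open>Euler's integral with a complex scale\<close>

lemma has_bochner_integral_Gamma_scaled:
  fixes p a :: real
  assumes "0 < p" "0 < a"
  shows "has_bochner_integral lborel (\<lambda>t. indicator {0<..} t *\<^sub>R (t powr (p - 1) * exp (- (a * t))))
    (Gamma p * a powr (- p))"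
proof -
  have "has_bochner_integral lborel (\<lambda>t. indicator {0..} t * t powr (p - 1) / exp t) (Gamma p)"
    using assms
    by (intro has_bochner_integral_nn_integral)
      (auto simp: Gamma_conv_nn_integral_real intro!: less_imp_le[OF Gamma_real_pos])
  hence "has_bochner_integral lborel (\<lambda>t. indicator {0..} (0 + a * t) * (0 + a * t) powr (p - 1) / exp (0 + a * t))
     (Gamma p /\<^sub>R \<bar>a\<bar>)"
    using assms by (subst (asm) lborel_has_bochner_integral_real_affine_iff[of a _ _ 0]) auto
  hence "has_bochner_integral lborel (\<lambda>t. a powr (1 - p) * (indicator {0..} (0 + a * t) * (0 + a * t) powr (p - 1) / exp (0 + a * t)))
     (a powr (1 - p) * (Gamma p /\<^sub>R \<bar>a\<bar>))"
    by (intro has_bochner_integral_mult_right)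
  also have "a powr (1 - p) * (Gamma p /\<^sub>R \<bar>a\<bar>) = Gamma p * a powr (- p)"
    using assms by (simp add: powr_diff powr_minus field_simps)
  also have "(\<lambda>t. a powr (1 - p) * (indicator {0..} (0 + a * t) * (0 + a * t) powr (p - 1) / exp (0 + a * t)))
      = (\<lambda>t. indicator {0<..} t *\<^sub>R (t powr (p - 1) * exp (- (a * t))))"
  proof
    fix t
    show "a powr (1 - p) * (indicator {0..} (0 + a * t) * (0 + a * t) powr (p - 1) / exp (0 + a * t))
      = indicator {0<..} t *\<^sub>R (t powr (p - 1) * exp (- (a * t)))"
    proof (cases "t > 0")
      case True
      have "a powr (1 - p) * a powr (p - 1) = 1"
        using assms by (simp flip: powr_add)
      with True show ?thesis using assms
        by (simp add: powr_mult exp_minus field_simps)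
    next
      case False
      \<comment> \<open>At \<open>t = 0\<close> the left side vanishes as well, because
        \<open>0 powr y\<close> is \<open>0\<close> for every \<open>y\<close>, including
        \<open>y = 0\<close>.\<close>
      thus ?thesis using assms by (cases "t = 0") (auto simp: indicator_def zero_le_mult_iff)
    qed
  qed
  finally show ?thesis .
qed

text \<open>Newton's binomial series at exponent \<open>- p\<close>; the sign of the generalized
  binomial coefficient cancels against that of \<open>(- z) ^ n\<close>.\<close>

lemma sums_pochhammer_over_fact:
  fixes p :: real and z :: complex
  assumes "norm z < 1"
  shows "(\<lambda>n. of_real (pochhammer p n / fact n) * z ^ n) sums (1 - z) powr (- of_real p)"
proof -
  have "(\<lambda>n. ((- of_real p) gchoose n) * (- z) ^ n) sums (1 + - z) powr (- of_real p)"
    using assms by (intro gen_binomial_complex) auto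
  moreover have "((- of_real p) gchoose n) * (- z) ^ n = of_real (pochhammer p n / fact n) * z ^ n" for n
  proof -
    have "(- 1) ^ n * (- z) ^ n = z ^ n"
      unfolding power_mult_distrib[symmetric] by simp
    thus ?thesis
      by (simp add: gbinomial_pochhammer pochhammer_of_real mult_ac)
  qed
  ultimately show ?thesis by simp
qed

text \<open>Expand \<open>exp (- c t)\<close> around a real \<open>a\<close> with \<open>|a - c| < a\<close>; such an \<open>a\<close> exists because
  \<open>Re c > 0\<close>, and the sum over the terms is a binomial series.\<close>
lemma has_bochner_integral_Gamma_complex_scaled:
  fixes p :: real and c :: complex
  assumes "0 < p" "0 < Re c"
  shows "has_bochner_integral lborel
    (\<lambda>t. indicator {0<..} t *\<^sub>R (of_real (t powr (p - 1)) * exp (- (c * of_real t))))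
    (of_real (Gamma p) * c powr (- of_real p))"
proof -
  \<comment> \<open>With this choice the cross term \<open>2 * a * Re c\<close> equals
    \<open>2 * (norm c)\<^sup>2\<close>, so the squared distance from \<open>a\<close> to
    \<open>c\<close> drops below \<open>a\<^sup>2\<close>.\<close>
  define a where "a = (norm c)\<^sup>2 / Re c"
  have c0: "norm c > 0" using assms by auto
  have a: "a > 0" using assms c0 by (auto simp: a_def)
  have "(norm (of_real a - c))\<^sup>2 = a\<^sup>2 - 2 * a * Re c + (norm c)\<^sup>2"
    unfolding cmod_power2 by (simp add: power2_eq_square algebra_simps)
  also have "\<dots> = a\<^sup>2 - (norm c)\<^sup>2"
    using assms by (simp add: a_def)
  also have "\<dots> < a\<^sup>2" using c0 by simp
  finally have ca: "norm (of_real a - c) < a"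
    using a by (meson less_imp_le power_less_imp_less_base)
  define z where "z = (of_real a - c) / of_real a"
  have z: "norm z < 1" using ca a by (simp add: z_def norm_divide)
  define f where "f n t = indicator {0<..} t *\<^sub>R (of_real (t powr (p - 1) * exp (- (a * t))) *
     ((of_real a - c) * of_real t) ^ n / fact n)" for n :: nat and t :: real
  have f_eq: "f n t = ((of_real a - c) ^ n / fact n) *
      of_real (indicator {0<..} t *\<^sub>R (t powr (p + real n - 1) * exp (- (a * t))))" for n t
    by (cases "t > 0") (auto simp: f_def power_mult_distrib powr_realpow powr_add powr_diff mult_ac)
  have "p + real n > 0" for n using assms by simp
  note G = has_bochner_integral_Gamma_scaled[OF this a]
  have coeff: "(of_real a - c) ^ n / fact n * of_real (Gamma (p + real n) * a powr (- (p + real n)))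
      = of_real (Gamma p * a powr (-p)) * (of_real (pochhammer p n / fact n) * z ^ n)" for n
  proof -
    have "pochhammer p n = Gamma (p + n) / Gamma p"
      using assms by (intro pochhammer_Gamma) auto
    moreover have "Gamma p \<noteq> 0" using assms by (simp add: Gamma_real_pos less_imp_neq[symmetric])
    moreover have "a powr (- (p + real n)) = a powr (- p) / a ^ n"
      using a by (simp add: powr_diff powr_realpow)
    ultimately show ?thesis using a by (simp add: z_def power_divide)
  qed
  have int_f: "has_bochner_integral lborel (f n)
     (of_real (Gamma p * a powr (-p)) * (of_real (pochhammer p n / fact n) * z ^ n))" for n
    unfolding f_eq coeff[symmetric]
    by (intro has_bochner_integral_mult_right has_bochner_integral_of_real G)
  have int_nf: "has_bochner_integral lborel (\<lambda>t. norm (f n t))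
     (Gamma p * a powr (-p) * (pochhammer p n / fact n * norm z ^ n))" for n
  proof -
    have "norm (f n t) = norm ((of_real a - c) ^ n / fact n) *
      (indicator {0<..} t *\<^sub>R (t powr (p + real n - 1) * exp (- (a * t))))" for t
      unfolding f_eq norm_mult norm_of_real by simp
    moreover have "has_bochner_integral lborel (\<lambda>t. norm ((of_real a - c) ^ n / fact n) *
      (indicator {0<..} t *\<^sub>R (t powr (p + real n - 1) * exp (- (a * t)))))
      (norm ((of_real a - c) ^ n / fact n) * (Gamma (p + real n) * a powr (- (p + real n))))"
      by (intro has_bochner_integral_mult_right G)
    moreover have "norm ((of_real a - c) ^ n / fact n) * (Gamma (p + real n) * a powr (- (p + real n)))
      = Gamma p * a powr (-p) * (pochhammer p n / fact n * norm z ^ n)"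
    proof -
      have "Gamma (p + real n) > 0" "Gamma p > 0" "pochhammer p n \<ge> 0"
        using assms by (auto intro!: Gamma_real_pos pochhammer_nonneg)
      thus ?thesis using arg_cong[OF coeff[of n], of norm]
        by (simp add: norm_mult norm_divide norm_power abs_mult)
    qed
    ultimately show ?thesis by simp
  qed
  \<comment> \<open>The same binomial series, evaluated at the real point \<open>norm z < 1\<close>,
    controls the integrals of the norms.\<close>
  have smb: "summable (\<lambda>n. pochhammer p n / fact n * norm z ^ n)"
  proof -
    have "(\<lambda>n. of_real (pochhammer p n / fact n) * of_real (norm z) ^ n) sums
       (1 - of_real (norm z)) powr (- complex_of_real p)"
      using z by (intro sums_pochhammer_over_fact) auto
    hence "summable (\<lambda>n. complex_of_real (pochhammer p n / fact n * norm z ^ n))"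
      by (simp add: sums_iff)
    thus ?thesis by (subst (asm) summable_complex_of_real)
  qed
  have f_sums: "(\<lambda>n. f n t) sums (indicator {0<..} t *\<^sub>R (of_real (t powr (p - 1)) * exp (- (c * of_real t))))" for t
  proof -
    have "(\<lambda>n. ((of_real a - c) * of_real t) ^ n /\<^sub>R fact n) sums exp ((of_real a - c) * of_real t)"
      by (rule exp_converges)
    hence "(\<lambda>n. (of_real (indicator {0<..} t * t powr (p - 1) * exp (- (a * t)))) * (((of_real a - c) * of_real t) ^ n /\<^sub>R fact n))
       sums (of_real (indicator {0<..} t * t powr (p - 1) * exp (- (a * t))) * exp ((of_real a - c) * of_real t))"
      by (rule sums_mult)
    also have "of_real (indicator {0<..} t * t powr (p - 1) * exp (- (a * t))) * exp ((of_real a - c) * of_real t)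
      = indicator {0<..} t *\<^sub>R (of_real (t powr (p - 1)) * exp (- (c * of_real t)))"
    proof -
      have "of_real (exp (- (a * t))) * exp ((of_real a - c) * of_real t) = exp (- (c * of_real t))"
        unfolding exp_of_real[symmetric] exp_add[symmetric] by (simp add: algebra_simps)
      thus ?thesis by (simp add: scaleR_conv_of_real mult.assoc)
    qed
    finally show ?thesis by (simp add: f_def[abs_def] scaleR_conv_of_real field_simps)
  qed
  have smf: "AE t in lborel. summable (\<lambda>n. norm (f n t))"
  proof (rule AE_I2)
    fix t
    have "summable (\<lambda>n. (indicator {0<..} t * t powr (p - 1) * exp (- (a * t))) *
       (norm ((of_real a - c) * of_real t) ^ n /\<^sub>R fact n))"
      by (intro summable_mult summable_exp_generic)
    thus "summable (\<lambda>n. norm (f n t))"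
      by (simp add: f_def norm_mult norm_divide norm_power field_simps abs_mult)
  qed
  note smi = summable_mult[OF smb, of "Gamma p * a powr (-p)"]
  have I: "integrable lborel (f n)" for n using int_f has_bochner_integral_iff by blast
  have smi': "summable (\<lambda>n. LINT t|lborel. norm (f n t))"
    using smi int_nf by (simp add: has_bochner_integral_iff)
  have "(\<lambda>n. integral\<^sup>L lborel (f n)) sums (LINT t|lborel. (\<Sum>n. f n t))"
    by (rule sums_integral[OF I smf smi'])
  moreover have "(\<lambda>n. integral\<^sup>L lborel (f n)) sums (of_real (Gamma p * a powr (-p)) * (1 - z) powr (- of_real p))"
    using int_f sums_mult[OF sums_pochhammer_over_fact[OF z, of p]]
    by (simp add: has_bochner_integral_iff)
  moreover have "of_real (Gamma p * a powr (-p)) * (1 - z) powr (- of_real p) = of_real (Gamma p) * c powr (- of_real p)"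
  proof -
    have "1 - z = c / of_real a" using a by (simp add: z_def field_simps)
    hence "c = of_real a * (1 - z)" using a by simp
    \<comment> \<open>The power splits on the principal branch because the factor \<open>a\<close>
      is a positive real.\<close>
    hence "c powr (- of_real p) = of_real a powr (- of_real p) * (1 - z) powr (- of_real p)"
      using a powr_times_real_left[of "of_real a" "1 - z" "- of_real p"] by simp
    moreover have "complex_of_real (a powr (-p)) = of_real a powr (- of_real p)"
      using a powr_of_real[of a "-p"] by simp
    ultimately show ?thesis by simp
  qed
  ultimately have "(LINT t|lborel. (\<Sum>n. f n t)) = of_real (Gamma p) * c powr (- of_real p)"
    using sums_unique2 by metis
  with integrable_suminf[OF I smf smi'] f_sums show ?thesis
    by (simp add: has_bochner_integral_iff sums_iff)
qed

subsection \<open>Hankel's formula\<close>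

text \<open>The threshold \<open>\<epsilon> powr (- 1 / (1 - \<kappa>))\<close> solves
  \<open>y powr (\<kappa> - 1) = \<epsilon>\<close>. Below it monotonicity gives the constant term;
  above it \<open>y powr \<kappa> = y * y powr (\<kappa> - 1)\<close> is at most
  \<open>\<epsilon> * y\<close>.\<close>

lemma powr_le_linear:
  fixes \<epsilon> \<kappa> y :: real
  assumes "0 \<le> \<kappa>" "\<kappa> < 1" "0 < \<epsilon>" "0 < y"
  shows "y powr \<kappa> \<le> \<epsilon> * y + (\<epsilon> powr (- 1 / (1 - \<kappa>))) powr \<kappa>"
proof (cases "y \<le> \<epsilon> powr (- 1 / (1 - \<kappa>))")
  case True
  hence "y powr \<kappa> \<le> (\<epsilon> powr (- 1 / (1 - \<kappa>))) powr \<kappa>"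
    using assms by (intro powr_mono2) auto
  moreover have "0 < \<epsilon> * y" using assms by simp
  ultimately show ?thesis by linarith
next
  case False
  hence "y powr (\<kappa> - 1) \<le> (\<epsilon> powr (- 1 / (1 - \<kappa>))) powr (\<kappa> - 1)"
    using assms by (intro powr_mono2') auto
  also have "\<dots> = \<epsilon>"
  proof -
    have "(- 1 / (1 - \<kappa>)) * (\<kappa> - 1) = 1" using assms by (simp add: divide_simps)
    thus ?thesis using assms unfolding powr_powr by simp
  qed
  finally have "y * y powr (\<kappa> - 1) \<le> y * \<epsilon>" using assms by (intro mult_left_mono) auto
  moreover have "y * y powr (\<kappa> - 1) = y powr \<kappa>" using assms by (simp add: powr_diff)
  ultimately show ?thesis by (simp add: mult.commute add_increasing2)
qed

lemma set_integrable_exp_minus: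
  fixes a :: real
  assumes "0 < a"
  shows "set_integrable lborel {0..} (\<lambda>r. exp (- (a * r)))"
proof -
  have "(\<lambda>r. exp (- a * r)) absolutely_integrable_on {0..}"
    using assms by (intro nonnegative_absolutely_integrable_1 integrable_on_exp_minus_to_infinity) auto
  thus ?thesis
    unfolding set_integrable_def by (subst (asm) integrable_completion) auto
qed

lemma set_integrable_exp_linear_powr:
  fixes a K \<kappa> :: real
  assumes "0 < a" "0 \<le> K" "0 \<le> \<kappa>" "\<kappa> < 1"
  shows "set_integrable lborel {0..} (\<lambda>r. exp (- (a * r) + K * (1 + r) powr \<kappa>))"
proof -
  \<comment> \<open>The factor \<open>K + 1\<close> keeps the denominator positive when
    \<open>K = 0\<close>; the sublinear term then costs at most half of the decay rate
    \<open>a\<close>.\<close>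
  define \<epsilon> where "\<epsilon> = a / (2 * (K + 1))"
  define M where "M = K * (\<epsilon> + (\<epsilon> powr (- 1 / (1 - \<kappa>))) powr \<kappa>)"
  have \<epsilon>: "\<epsilon> > 0" using assms by (simp add: \<epsilon>_def)
  have K\<epsilon>: "K * \<epsilon> \<le> a / 2" using assms by (simp add: \<epsilon>_def field_simps)
  have bound: "- (a * r) + K * (1 + r) powr \<kappa> \<le> M - (a / 2) * r" if "r \<ge> 0" for r
  proof -
    have "K * (1 + r) powr \<kappa> \<le> K * (\<epsilon> * (1 + r) + (\<epsilon> powr (- 1 / (1 - \<kappa>))) powr \<kappa>)"
      using assms \<epsilon> that by (intro mult_left_mono powr_le_linear) auto
    also have "\<dots> = M + (K * \<epsilon>) * r" by (simp add: M_def algebra_simps)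
    also have "\<dots> \<le> M + (a / 2) * r" using K\<epsilon> that by (intro add_left_mono mult_right_mono) auto
    finally show ?thesis by simp
  qed
  have "set_integrable lborel {0..} (\<lambda>r. exp M * exp (- ((a / 2) * r)))"
    using assms by (intro set_integrable_mult_right set_integrable_exp_minus) auto
  thus ?thesis
  proof (rule set_integrable_bound)
    show "AE r in lborel. r \<in> {0..} \<longrightarrow>
      norm (exp (- (a * r) + K * (1 + r) powr \<kappa>)) \<le> norm (exp M * exp (- ((a / 2) * r)))"
      using bound by (auto simp flip: exp_add)
  qed (auto simp: set_borel_measurable_def)
qed

text \<open>Follows from \<open>ln (sqrt y) \<le> sqrt y\<close>. It puts polynomial factors under
  the same stretched exponential bound, with exponent \<open>1 / 2\<close>.\<close>

lemma powr_le_exp_sqrt: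
  fixes q y :: real
  assumes "0 \<le> q" "1 \<le> y"
  shows "y powr q \<le> exp (2 * q * y powr (1 / 2))"
proof -
  have "ln (sqrt y) \<le> sqrt y" using assms ln_le_minus_one[of "sqrt y"] by simp
  hence "ln y \<le> 2 * sqrt y" using assms by (simp add: ln_sqrt)
  hence "q * ln y \<le> q * (2 * sqrt y)" using assms by (intro mult_left_mono) auto
  thus ?thesis using assms by (simp add: powr_def powr_half_sqrt[symmetric] mult_ac)
qed

section \<open>Rays of the Hankel contour\<close>

definition hankel_ray :: "real \<Rightarrow> real \<Rightarrow> real \<Rightarrow> complex" where
  "hankel_ray \<theta> c r = of_real c + of_real r * cis \<theta>"

lemma continuous_on_hankel_ray [continuous_intros]: "continuous_on S (hankel_ray \<theta> c)"
  unfolding hankel_ray_def by (intro continuous_intros)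

lemma has_vector_derivative_hankel_ray:
  "(hankel_ray \<theta> c has_vector_derivative cis \<theta>) (at r within S)"
  unfolding hankel_ray_def
  by (auto intro!: derivative_eq_intros has_vector_derivative_of_real
     simp: has_vector_derivative_def scaleR_conv_of_real bounded_linear_mult_left)

text \<open>Angles above \<open>pi / 2\<close> make \<open>exp\<close> decay along the ray; angles
  below \<open>pi\<close> keep the ray off the branch cut of \<open>powr\<close>.\<close>

locale hankel_angle =
  fixes \<theta> :: real
  assumes angle_gt: "pi / 2 < \<theta>" and angle_less: "\<theta> < pi"
begin

lemma sin_pos: "0 < sin \<theta>"
  using angle_gt angle_less by (intro sin_gt_zero) (auto intro: less_trans[OF _ angle_gt])

lemma cos_neg: "cos \<theta> < 0"
  using angle_gt angle_less cos_gt_zero_pi[of "\<theta> - pi"] by simp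

lemma hankel_ray_not_nonpos:
  assumes "0 < c \<or> c = 0 \<and> r \<noteq> 0"
  shows "hankel_ray \<theta> c r \<notin> \<real>\<^sub>\<le>\<^sub>0"
  using assms sin_pos by (auto simp: complex_nonpos_Reals_iff hankel_ray_def)

lemma norm_hankel_ray_le:
  assumes "0 \<le> c" "0 \<le> r"
  shows "norm (hankel_ray \<theta> c r) \<le> c + r"
  using assms norm_triangle_ineq[of "of_real c" "of_real r * cis \<theta>"]
  by (simp add: hankel_ray_def norm_mult)

lemma norm_hankel_ray_ge_radius: "\<bar>r\<bar> * sin \<theta> \<le> norm (hankel_ray \<theta> c r)"
  using abs_Im_le_cmod[of "hankel_ray \<theta> c r"] sin_pos by (simp add: hankel_ray_def abs_mult)

text \<open>\<open>c * sin \<theta>\<close> is the distance from the origin to the line carrying the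
  ray. Rotation by \<open>cis (- \<theta>)\<close> makes that line horizontal and turns the distance
  into an imaginary part.\<close>

lemma norm_hankel_ray_ge_base:
  assumes "0 \<le> c"
  shows "c * sin \<theta> \<le> norm (hankel_ray \<theta> c r)"
proof -
  have "c * sin \<theta> = \<bar>Im (hankel_ray \<theta> c r * cis (- \<theta>))\<bar>"
    using assms sin_pos by (simp add: hankel_ray_def algebra_simps)
  also have "\<dots> \<le> norm (hankel_ray \<theta> c r * cis (- \<theta>))" by (rule abs_Im_le_cmod)
  finally show ?thesis by (simp add: norm_mult)
qed

lemma norm_exp_hankel_ray: "norm (exp (hankel_ray \<theta> c r)) = exp (c + r * cos \<theta>)"
  by (simp add: hankel_ray_def)

lemma hankel_ray_nonzero:
  assumes "0 < c \<or> c = 0 \<and> r \<noteq> 0"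
  shows "hankel_ray \<theta> c r \<noteq> 0"
  using hankel_ray_not_nonpos[OF assms] by (auto simp: complex_nonpos_Reals_iff)

lemma continuous_on_hankel_ray_powr:
  "0 < c \<Longrightarrow> continuous_on S (\<lambda>r. hankel_ray \<theta> c r powr w)"
  using hankel_ray_not_nonpos[of c] hankel_ray_nonzero[of c]
  by (intro continuous_intros) (force simp: complex_nonpos_Reals_iff)+

lemma borel_measurable_hankel_ray_powr [measurable]:
  assumes "0 < c"
  shows "(\<lambda>r. hankel_ray \<theta> c r powr w) \<in> borel_measurable borel"
  using assms by (intro borel_measurable_continuous_onI continuous_on_hankel_ray_powr)

lemma borel_measurable_hankel_ray [measurable]: "hankel_ray \<theta> c \<in> borel_measurable borel"
  by (intro borel_measurable_continuous_onI continuous_intros)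

text \<open>For \<open>w \<ge> 0\<close> the linear growth of the ray decides, for
  \<open>w < 0\<close> its distance from the origin.\<close>

lemma norm_hankel_ray_powr_le:
  fixes c w :: real
  assumes "0 < c"
  obtains C where "0 \<le> C" "\<And>r. 0 \<le> r \<Longrightarrow> norm (hankel_ray \<theta> c r) powr w \<le> C * (1 + r) powr \<bar>w\<bar>"
proof (cases "w \<ge> 0")
  case True
  have "norm (hankel_ray \<theta> c r) powr w \<le> (c + 1) powr w * (1 + r) powr \<bar>w\<bar>" if "r \<ge> 0" for r
  proof -
    have "norm (hankel_ray \<theta> c r) \<le> (c + 1) * (1 + r)"
      using norm_hankel_ray_le[of c r] mult_nonneg_nonneg[of c r] assms that
      unfolding ring_distribs by linarith
    hence "norm (hankel_ray \<theta> c r) powr w \<le> ((c + 1) * (1 + r)) powr w"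
      using True by (intro powr_mono2) auto
    thus ?thesis using assms that True by (simp add: powr_mult)
  qed
  thus ?thesis by (intro that[of "(c + 1) powr w"]) auto
next
  case False
  have "norm (hankel_ray \<theta> c r) powr w \<le> (c * sin \<theta>) powr w * (1 + r) powr \<bar>w\<bar>" if "r \<ge> 0" for r
  proof -
    have "norm (hankel_ray \<theta> c r) powr w \<le> (c * sin \<theta>) powr w * 1"
      using False assms sin_pos norm_hankel_ray_ge_base[of c r] by (simp add: powr_mono2')
    also have "\<dots> \<le> (c * sin \<theta>) powr w * (1 + r) powr \<bar>w\<bar>"
      using that by (intro mult_left_mono ge_one_powr_ge_zero) auto
    finally show ?thesis .
  qed
  thus ?thesis by (intro that[of "(c * sin \<theta>) powr w"]) auto
qed

text \<open>Along the ray \<open>exp\<close> decays at the rate \<open>- cos \<theta> > 0\<close>,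
  which beats any stretched exponential with exponent below 1.\<close>

lemma set_integrable_hankel:
  fixes f :: "real \<Rightarrow> complex" and c C K \<kappa> :: real
  assumes [measurable]: "f \<in> borel_measurable borel"
    and "0 \<le> K" "0 \<le> \<kappa>" "\<kappa> < 1"
    and f: "\<And>r. 0 \<le> r \<Longrightarrow> norm (f r) \<le> C * exp (K * (1 + r) powr \<kappa>)"
  shows "set_integrable lborel {0..} (\<lambda>r. exp (hankel_ray \<theta> c r) * cis \<theta> * f r)"
proof -
  have "set_integrable lborel {0..} (\<lambda>r. exp c * C * exp (- ((- cos \<theta>) * r) + K * (1 + r) powr \<kappa>))"
    using assms cos_neg by (intro set_integrable_mult_right set_integrable_exp_linear_powr) auto
  thus ?thesis
  proof (rule set_integrable_bound)
    show "AE r in lborel. r \<in> {0..} \<longrightarrow> norm (exp (hankel_ray \<theta> c r) * cis \<theta> * f r)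
       \<le> norm (exp c * C * exp (- ((- cos \<theta>) * r) + K * (1 + r) powr \<kappa>))"
    proof (intro AE_I2 impI)
      fix r :: real assume "r \<in> {0..}"
      hence "norm (exp (hankel_ray \<theta> c r) * cis \<theta> * f r) \<le>
         exp (c + r * cos \<theta>) * (C * exp (K * (1 + r) powr \<kappa>))"
        unfolding norm_mult norm_exp_hankel_ray using f by simp
      also have "\<dots> = exp c * C * exp (- ((- cos \<theta>) * r) + K * (1 + r) powr \<kappa>)"
        by (simp add: exp_add algebra_simps)
      finally show "norm (exp (hankel_ray \<theta> c r) * cis \<theta> * f r)
       \<le> norm (exp c * C * exp (- ((- cos \<theta>) * r) + K * (1 + r) powr \<kappa>))" by simp
    qed
  qed (auto simp: set_borel_measurable_def)
qed

lemma set_integrable_hankel_powr: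
  fixes c w :: real
  assumes "0 < c"
  shows "set_integrable lborel {0..} (\<lambda>r. exp (hankel_ray \<theta> c r) * cis \<theta> * hankel_ray \<theta> c r powr (of_real w))"
proof -
  obtain C where C: "0 \<le> C" "\<And>r. 0 \<le> r \<Longrightarrow> norm (hankel_ray \<theta> c r) powr w \<le> C * (1 + r) powr \<bar>w\<bar>"
    using norm_hankel_ray_powr_le[OF assms] by metis
  show ?thesis
  proof (rule set_integrable_hankel)
    show "norm (hankel_ray \<theta> c r powr of_real w) \<le> C * exp (2 * \<bar>w\<bar> * (1 + r) powr (1 / 2))" if "0 \<le> r" for r
    proof -
      have "norm (hankel_ray \<theta> c r powr of_real w) = norm (hankel_ray \<theta> c r) powr w"
        by (subst norm_powr_real_powr') auto
      also have "\<dots> \<le> C * (1 + r) powr \<bar>w\<bar>" by (rule C(2)[OF that])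
      also have "\<dots> \<le> C * exp (2 * \<bar>w\<bar> * (1 + r) powr (1 / 2))"
        using that C(1) by (intro mult_left_mono powr_le_exp_sqrt) auto
      finally show ?thesis .
    qed
  qed (use assms in auto)
qed

text \<open>
  The contour is the ray from 1 in direction \<open>cis \<theta>\<close> together with its mirror image. For
  \<open>f (cnj u) = cnj (f u)\<close> the two halves of \<open>(2 \<pi> i)\<^sup>-\<^sup>1 \<integral> e\<^sup>u f(u) du\<close> are complex conjugates,
  so the imaginary part over the upper ray suffices.
\<close>
definition hankel_functional :: "(complex \<Rightarrow> complex) \<Rightarrow> real" where
  "hankel_functional f =
     Im (LINT r:{0..}|lborel. exp (hankel_ray \<theta> 1 r) * cis \<theta> * f (hankel_ray \<theta> 1 r)) / pi"

section \<open>Recurrence and shift of the contour integral\<close>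

text \<open>The fundamental theorem of calculus on \<open>{0..T}\<close>, followed by
  \<open>T\<close> tending to infinity.\<close>

lemma tendsto_primitive_along_hankel_ray:
  fixes F G :: "complex \<Rightarrow> complex" and c :: real
  assumes "0 < c"
    and deriv: "\<And>u. u \<notin> \<real>\<^sub>\<le>\<^sub>0 \<Longrightarrow> (G has_field_derivative F u) (at u)"
    and cont: "continuous_on (- \<real>\<^sub>\<le>\<^sub>0) F"
    and int: "set_integrable lborel {0..} (\<lambda>r. F (hankel_ray \<theta> c r) * cis \<theta>)"
  shows "((\<lambda>T. G (hankel_ray \<theta> c T) - G (of_real c)) \<longlongrightarrow>
     (LINT r:{0..}|lborel. F (hankel_ray \<theta> c r) * cis \<theta>)) at_top"
proof (rule Lim_transform_eventually)
  show "((\<lambda>T. LINT r:{0..T}|lborel. F (hankel_ray \<theta> c r) * cis \<theta>) \<longlongrightarrow>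
     (LINT r:{0..}|lborel. F (hankel_ray \<theta> c r) * cis \<theta>)) at_top"
    by (rule tendsto_set_lebesgue_integral_at_top[OF _ int]) auto
  show "eventually (\<lambda>T. (LINT r:{0..T}|lborel. F (hankel_ray \<theta> c r) * cis \<theta>) =
     G (hankel_ray \<theta> c T) - G (of_real c)) at_top"
    using eventually_ge_at_top[of 0]
  proof eventually_elim
    case (elim T)
    have "((G \<circ> hankel_ray \<theta> c) has_vector_derivative F (hankel_ray \<theta> c r) * cis \<theta>) (at r within {0..T})" for r
    proof -
      have "((G \<circ> hankel_ray \<theta> c) has_vector_derivative cis \<theta> * F (hankel_ray \<theta> c r)) (at r)"
        using hankel_ray_not_nonpos[of c r] assms(1)
        by (intro field_vector_diff_chain_at has_vector_derivative_hankel_ray deriv) auto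
      thus ?thesis by (simp add: mult.commute has_vector_derivative_at_within)
    qed
    moreover have "continuous_on {0..T} (\<lambda>r. F (hankel_ray \<theta> c r) * cis \<theta>)"
      using hankel_ray_not_nonpos[of c] assms(1)
      by (intro continuous_on_mult continuous_on_const continuous_on_compose2[OF cont] continuous_intros) auto
    ultimately have "(\<integral>r. indicator {0..T} r *\<^sub>R (F (hankel_ray \<theta> c r) * cis \<theta>) \<partial>lborel)
       = (G \<circ> hankel_ray \<theta> c) T - (G \<circ> hankel_ray \<theta> c) 0"
      using elim by (intro integral_FTC_Icc)
    thus ?case unfolding set_lebesgue_integral_def by (simp only: o_def) (simp add: hankel_ray_def)
  qed
qed

lemma tendsto_exp_mult_powr_hankel_ray:
  fixes c w :: real
  assumes "0 < c"
  shows "((\<lambda>T. exp (hankel_ray \<theta> c T) * hankel_ray \<theta> c T powr (of_real w)) \<longlongrightarrow> 0) at_top"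
proof -
  obtain C where C: "0 \<le> C" "\<And>r. 0 \<le> r \<Longrightarrow> norm (hankel_ray \<theta> c r) powr w \<le> C * (1 + r) powr \<bar>w\<bar>"
    using norm_hankel_ray_powr_le[OF assms] by metis
  define a where "a = - cos \<theta>"
  have a: "a > 0" using cos_neg by (simp add: a_def)
  have "((\<lambda>T. exp (c - a * T) * (C * (1 + T) powr \<bar>w\<bar>)) \<longlongrightarrow> 0) at_top"
    using a by real_asymp
  thus ?thesis
  proof (rule Lim_null_comparison[rotated])
    show "eventually (\<lambda>T. norm (exp (hankel_ray \<theta> c T) * hankel_ray \<theta> c T powr (of_real w))
       \<le> exp (c - a * T) * (C * (1 + T) powr \<bar>w\<bar>)) at_top"
      using eventually_ge_at_top[of 0]
    proof eventually_elim
      case (elim T)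
      have "norm (hankel_ray \<theta> c T powr of_real w) = norm (hankel_ray \<theta> c T) powr w"
        by (subst norm_powr_real_powr') auto
      thus ?case using C(2)[OF elim]
        unfolding norm_mult norm_exp_hankel_ray by (simp add: a_def mult.commute)
    qed
  qed
qed

text \<open>Integration by parts: \<open>F\<close> is the derivative of
  \<open>exp u * u powr (- w)\<close>, whose boundary value vanishes at infinity and is real at the
  vertex. The result mirrors \<open>rGamma w = w * rGamma (w + 1)\<close>.\<close>

lemma hankel_functional_powr_rec:
  fixes w :: real
  shows "hankel_functional (\<lambda>u. u powr (of_real (- w))) =
    w * hankel_functional (\<lambda>u. u powr (of_real (- (w + 1))))"
proof -
  define G where "G u = exp u * u powr of_real (- w)" for u :: complex
  define F where "F u = exp u * u powr of_real (- w) - of_real w * (exp u * u powr of_real (- (w + 1)))" for u :: complex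
  let ?I = "\<lambda>w. LINT r:{0..}|lborel. exp (hankel_ray \<theta> 1 r) * cis \<theta> * hankel_ray \<theta> 1 r powr of_real w"
  have eq: "F (hankel_ray \<theta> 1 r) * cis \<theta> = exp (hankel_ray \<theta> 1 r) * cis \<theta> * hankel_ray \<theta> 1 r powr of_real (- w)
     - of_real w * (exp (hankel_ray \<theta> 1 r) * cis \<theta> * hankel_ray \<theta> 1 r powr of_real (- (w + 1)))" for r
    by (simp add: F_def algebra_simps)
  have deriv: "(G has_field_derivative F u) (at u)" if "u \<notin> \<real>\<^sub>\<le>\<^sub>0" for u
  proof -
    have "complex_of_real (- (w + 1)) = of_real (- w) - 1" by simp
    thus ?thesis
      unfolding G_def F_def using that
      by (auto intro!: derivative_eq_intros simp: mult_ac)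
  qed
  have cont: "continuous_on (- \<real>\<^sub>\<le>\<^sub>0) F"
    unfolding F_def by (intro continuous_intros) (auto simp: complex_nonpos_Reals_iff)
  have "((\<lambda>T. G (hankel_ray \<theta> 1 T) - G (of_real 1)) \<longlongrightarrow>
     (LINT r:{0..}|lborel. F (hankel_ray \<theta> 1 r) * cis \<theta>)) at_top"
  proof (rule tendsto_primitive_along_hankel_ray[OF _ deriv cont])
    show "set_integrable lborel {0..} (\<lambda>r. F (hankel_ray \<theta> 1 r) * cis \<theta>)"
      unfolding eq by (intro set_integral_diff(1) set_integrable_mult_right set_integrable_hankel_powr zero_less_one)
  qed auto
  moreover have "((\<lambda>T. G (hankel_ray \<theta> 1 T) - G (of_real 1)) \<longlongrightarrow> 0 - G (of_real 1)) at_top"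
    unfolding G_def by (intro tendsto_diff tendsto_const tendsto_exp_mult_powr_hankel_ray) auto
  ultimately have "(LINT r:{0..}|lborel. F (hankel_ray \<theta> 1 r) * cis \<theta>) = 0 - G (of_real 1)"
    by (rule tendsto_unique[OF trivial_limit_at_top_linorder])
  moreover have "(LINT r:{0..}|lborel. F (hankel_ray \<theta> 1 r) * cis \<theta>) = ?I (- w) - of_real w * ?I (- (w + 1))"
    unfolding eq
    using set_integrable_hankel_powr[of 1 "- w"] set_integrable_hankel_powr[of 1 "- (w + 1)"]
    by (subst set_integral_diff) (simp_all only: set_integral_mult_right set_integrable_mult_right zero_less_one)
  \<comment> \<open>The boundary term \<open>G 1\<close> is \<open>exp 1\<close>, a real number, so
    it disappears from the imaginary part.\<close>
  ultimately have "Im (?I (- w)) = w * Im (?I (- (w + 1)))"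
    by (simp add: G_def complex_eq_iff Im_exp)
  thus ?thesis by (simp add: hankel_functional_def)
qed

text \<open>Shifting the ray horizontally adds only an integral over a piece of the positive real axis,
  which is real.\<close>
lemma Im_hankel_integral_shift:
  fixes c w :: real
  assumes "0 < w" "0 < c" "c < 1"
  shows "Im (LINT r:{0..}|lborel. exp (hankel_ray \<theta> c r) * cis \<theta> * hankel_ray \<theta> c r powr (of_real (- w))) =
     Im (LINT r:{0..}|lborel. exp (hankel_ray \<theta> 1 r) * cis \<theta> * hankel_ray \<theta> 1 r powr (of_real (- w)))"
proof -
  define F where "F u = exp u * u powr of_real (- w)" for u :: complex
  define I where "I c = (LINT r:{0..}|lborel. F (hankel_ray \<theta> c r) * cis \<theta>)" for c
  have I_eq: "I c = (LINT r:{0..}|lborel. exp (hankel_ray \<theta> c r) * cis \<theta> * hankel_ray \<theta> c r powr (of_real (- w)))" for c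
    by (simp add: I_def F_def mult_ac)
  have slit: "- complex_of_real ` {..0} = - \<real>\<^sub>\<le>\<^sub>0"
    by (auto simp: nonpos_Reals_def)
  have cont: "continuous_on (- \<real>\<^sub>\<le>\<^sub>0) F"
    unfolding F_def by (intro continuous_intros) (auto simp: complex_nonpos_Reals_iff)
  \<comment> \<open>The slit plane is starlike, so the holomorphic \<open>F\<close> has one
    primitive serving both rays and the real segment between their vertices.\<close>
  have "\<exists>G. \<forall>u\<in>- \<real>\<^sub>\<le>\<^sub>0. (G has_field_derivative F u) (at u)"
  proof (rule holomorphic_starlike_primitive[where k = "{}", OF cont])
    show "starlike (- \<real>\<^sub>\<le>\<^sub>0 :: complex set)"
      using starlike_slotted_complex_plane_left[of 0] by (simp only: slit of_real_0)
    fix u :: complex assume "u \<in> - \<real>\<^sub>\<le>\<^sub>0 - {}"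
    hence "(F has_field_derivative exp u * (of_real (- w) * u powr (of_real (- w) - 1)) + exp u * u powr of_real (- w)) (at u)"
      unfolding F_def by (auto intro!: derivative_eq_intros)
    thus "F field_differentiable at u" by (auto simp only: field_differentiable_def)
  qed auto
  then obtain G where G: "\<And>u. u \<notin> \<real>\<^sub>\<le>\<^sub>0 \<Longrightarrow> (G has_field_derivative F u) (at u)"
    by auto
  have lim: "((\<lambda>T. G (hankel_ray \<theta> c T) - G (of_real c)) \<longlongrightarrow> I c) at_top" if "0 < c" for c
  proof -
    have "set_integrable lborel {0..} (\<lambda>r. F (hankel_ray \<theta> c r) * cis \<theta>)"
      using set_integrable_hankel_powr[OF that, of "- w"] by (simp add: F_def mult_ac)
    from tendsto_primitive_along_hankel_ray[OF that G cont this] show ?thesis by (simp add: I_def)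
  qed
  have "((\<lambda>T. (G (hankel_ray \<theta> 1 T) - G (of_real 1)) - (G (hankel_ray \<theta> c T) - G (of_real c))) \<longlongrightarrow> I 1 - I c) at_top"
    using assms by (intro tendsto_diff lim) auto
  \<comment> \<open>The ends of the two rays are joined by a horizontal segment of fixed length
    \<open>1 - c\<close>, on which \<open>F\<close> is exponentially small.\<close>
  moreover have "((\<lambda>T. G (hankel_ray \<theta> 1 T) - G (hankel_ray \<theta> c T)) \<longlongrightarrow> 0) at_top"
  proof (rule Lim_null_comparison)
    define a where "a = - cos \<theta>"
    have a: "a > 0" using cos_neg by (simp add: a_def)
    define b where "b = sin \<theta>"
    have b: "b > 0" using sin_pos by (simp add: b_def)
    show "((\<lambda>T. exp (1 - a * T) * norm (hankel_ray \<theta> 1 T - hankel_ray \<theta> c T)) \<longlongrightarrow> 0) at_top"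
    proof -
      have "((\<lambda>T. exp (1 - a * T) * k) \<longlongrightarrow> 0) at_top" for k
        using a by real_asymp
      from this[of "norm (1 - complex_of_real c)"] have
        "((\<lambda>T. exp (1 - a * T) * norm (1 - complex_of_real c)) \<longlongrightarrow> 0) at_top" .
      thus ?thesis by (simp add: hankel_ray_def)
    qed
    show "eventually (\<lambda>T. norm (G (hankel_ray \<theta> 1 T) - G (hankel_ray \<theta> c T)) \<le>
       exp (1 - a * T) * norm (hankel_ray \<theta> 1 T - hankel_ray \<theta> c T)) at_top"
      \<comment> \<open>From here on the joining segment stays outside the unit disc, so
        \<open>u powr (- w)\<close> has norm at most 1.\<close>
      using eventually_ge_at_top[of "1 / b"]
    proof eventually_elim
      case (elim T)
      have Tb: "1 \<le> T * b" using elim b by (simp add: field_simps)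
      have T: "0 < T" using elim b by (smt (verit) divide_pos_pos)
      have S: "\<exists>d. c \<le> d \<and> d \<le> 1 \<and> u = hankel_ray \<theta> d T" if u: "u \<in> closed_segment (hankel_ray \<theta> 1 T) (hankel_ray \<theta> c T)" for u
      proof -
        from u obtain t where t: "0 \<le> t" "t \<le> 1" "u = (1 - t) *\<^sub>R hankel_ray \<theta> 1 T + t *\<^sub>R hankel_ray \<theta> c T"
          by (auto simp: closed_segment_def)
        have "u = hankel_ray \<theta> (1 - t + t * c) T"
          by (simp add: t hankel_ray_def scaleR_conv_of_real algebra_simps)
        moreover have "c \<le> 1 - t + t * c"
          using mult_nonneg_nonneg[of "1 - t" "1 - c"] t assms by (simp add: algebra_simps)
        moreover have "1 - t + t * c \<le> 1" using mult_left_mono[of c 1 t] t assms by simp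
        ultimately show ?thesis by blast
      qed
      show ?case
      proof (rule field_differentiable_bound[of "closed_segment (hankel_ray \<theta> 1 T) (hankel_ray \<theta> c T)" G F])
        fix u assume "u \<in> closed_segment (hankel_ray \<theta> 1 T) (hankel_ray \<theta> c T)"
        then obtain d where d: "c \<le> d" "d \<le> 1" "u = hankel_ray \<theta> d T" using S by blast
        show "(G has_field_derivative F u) (at u within closed_segment (hankel_ray \<theta> 1 T) (hankel_ray \<theta> c T))"
          using d assms hankel_ray_not_nonpos[of d T] by (intro has_field_derivative_at_within[OF G]) auto
        have "norm (u powr of_real (- w)) = norm u powr (- w)"
          by (subst norm_powr_real_powr') auto
        also have "\<dots> \<le> 1 powr (- w)"
          using norm_hankel_ray_ge_radius[of T d] Tb T assms d by (intro powr_mono2') (auto simp: b_def)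
        finally have "norm (F u) \<le> exp (d + T * cos \<theta>) * 1"
          unfolding F_def norm_mult d norm_exp_hankel_ray by (intro mult_left_mono) auto
        also have "\<dots> \<le> exp (1 - a * T)" using d by (simp add: a_def mult.commute)
        finally show "norm (F u) \<le> exp (1 - a * T)" .
      qed auto
    qed
  qed
  hence "((\<lambda>T. (G (hankel_ray \<theta> 1 T) - G (hankel_ray \<theta> c T)) - (G (of_real 1) - G (of_real c))) \<longlongrightarrow>
     0 - (G (of_real 1) - G (of_real c))) at_top"
    by (intro tendsto_diff tendsto_const)
  hence "((\<lambda>T. (G (hankel_ray \<theta> 1 T) - G (of_real 1)) - (G (hankel_ray \<theta> c T) - G (of_real c))) \<longlongrightarrow>
     0 - (G (of_real 1) - G (of_real c))) at_top"
    by (rule Lim_transform_eventually) (simp add: algebra_simps)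
  ultimately have "I 1 - I c = 0 - (G (of_real 1) - G (of_real c))"
    by (rule tendsto_unique[OF trivial_limit_at_top_linorder])
  \<comment> \<open>On the positive real axis \<open>F\<close> is real, so the imaginary part of its
    primitive is constant there.\<close>
  moreover have "Im (G (of_real 1)) = Im (G (of_real c))"
  proof -
    have D: "((\<lambda>t. Im (G (of_real t))) has_real_derivative 0) (at t)" if "c \<le> t" "t \<le> 1" for t
    proof -
      have "((G \<circ> of_real) has_vector_derivative 1 * F (of_real t)) (at t)"
      proof (intro field_vector_diff_chain_at G)
        show "(complex_of_real has_vector_derivative 1) (at t)"
          using has_vector_derivative_of_real[OF DERIV_ident] by simp
        show "complex_of_real t \<notin> \<real>\<^sub>\<le>\<^sub>0"
          using that assms by (simp add: complex_nonpos_Reals_iff)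
      qed
      hence "((\<lambda>t. Im ((G \<circ> of_real) t)) has_vector_derivative Im (1 * F (of_real t))) (at t)"
        by (rule bounded_linear.has_vector_derivative[OF bounded_linear_Im])
      moreover have "F (of_real t) = of_real (exp t * t powr (- w))"
        using that assms powr_of_real[of t "- w"] by (simp add: F_def exp_of_real)
      ultimately show ?thesis by (simp add: has_real_derivative_iff_has_vector_derivative)
    qed
    have "continuous_on {c..1} (\<lambda>t. Im (G (of_real t)))"
      by (rule DERIV_atLeastAtMost_imp_continuous_on) (use D in blast)
    from DERIV_isconst_end[OF assms(3) this] D show ?thesis by simp
  qed
  ultimately have "Im (I c) = Im (I 1)" by (simp add: complex_eq_iff)
  thus ?thesis by (simp add: I_eq)
qed

section \<open>Evaluation of the contour integral of a power\<close>

text \<open>With the vertex at the origin the integral is Euler's integral for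
  \<open>Gamma (1 - w)\<close> with complex scale \<open>- cis \<theta>\<close>, whose real part is
  positive. The reflection formula then turns \<open>Gamma (1 - w) * sin (pi * w)\<close> into
  \<open>pi * rGamma w\<close>.\<close>

lemma Im_hankel_integral_at_zero:
  fixes w :: real
  assumes "0 < w" "w < 1"
  shows "Im (LINT r:{0..}|lborel. exp (hankel_ray \<theta> 0 r) * cis \<theta> * hankel_ray \<theta> 0 r powr (of_real (- w)))
    = pi * rGamma w"
proof -
  have Re: "0 < Re (- cis \<theta>)" using cos_neg by simp
  \<comment> \<open>Both \<open>\<theta> - pi\<close> and \<open>\<theta>\<close> lie in the range
    of the principal argument.\<close>
  have ln: "Ln (- cis \<theta>) = \<i> * of_real (\<theta> - pi)" "Ln (cis \<theta>) = \<i> * of_real \<theta>"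
  proof -
    have e: "exp (\<i> * of_real (\<theta> - pi)) = - cis \<theta>"
      by (simp add: cis_conv_exp algebra_simps exp_diff)
    show "Ln (- cis \<theta>) = \<i> * of_real (\<theta> - pi)"
      unfolding e[symmetric] using angle_gt angle_less by (intro Ln_exp) auto
    show "Ln (cis \<theta>) = \<i> * of_real \<theta>"
      unfolding cis_conv_exp using angle_gt angle_less pi_gt_zero by (intro Ln_exp) (simp_all del: pi_gt_zero)
  qed
  have "(LINT r:{0..}|lborel. exp (hankel_ray \<theta> 0 r) * cis \<theta> * hankel_ray \<theta> 0 r powr (of_real (- w)))
    = (\<integral>r. cis (\<theta> * (1 - w)) * (indicator {0<..} r *\<^sub>R
          (of_real (r powr ((1 - w) - 1)) * exp (- (- cis \<theta> * of_real r)))) \<partial>lborel)"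
    unfolding set_lebesgue_integral_def
  proof (rule Bochner_Integration.integral_cong[OF refl])
    fix r :: real
    show "indicator {0..} r *\<^sub>R (exp (hankel_ray \<theta> 0 r) * cis \<theta> * hankel_ray \<theta> 0 r powr (of_real (- w)))
      = cis (\<theta> * (1 - w)) * (indicator {0<..} r *\<^sub>R
          (of_real (r powr ((1 - w) - 1)) * exp (- (- cis \<theta> * of_real r))))"
    proof (cases "r > 0")
      case True
      have "hankel_ray \<theta> 0 r powr (of_real (- w)) = of_real r powr (of_real (- w)) * cis \<theta> powr (of_real (- w))"
        unfolding hankel_ray_def using True
        by (subst powr_times_real_left[symmetric]) auto
      also have "of_real r powr (of_real (- w)) = complex_of_real (r powr (- w))"
        using True by (intro powr_of_real) auto
      also have "cis \<theta> powr (of_real (- w)) = cis (- w * \<theta>)"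
        using ln by (simp add: powr_def cis_conv_exp mult_ac)
      finally have p: "hankel_ray \<theta> 0 r powr (of_real (- w)) = of_real (r powr (- w)) * cis (- w * \<theta>)" .
      have c: "cis \<theta> * cis (- w * \<theta>) = cis (\<theta> * (1 - w))"
        by (simp add: cis_mult algebra_simps)
      have "exp (hankel_ray \<theta> 0 r) * cis \<theta> * (of_real (r powr (- w)) * cis (- w * \<theta>)) =
         (cis \<theta> * cis (- w * \<theta>)) * (of_real (r powr (- w)) * exp (hankel_ray \<theta> 0 r))"
        by (simp only: mult_ac)
      thus ?thesis using True unfolding p c by (simp add: hankel_ray_def mult_ac)
    next
      case False
      thus ?thesis by (cases "r = 0") (auto simp: hankel_ray_def)
    qed
  qed
  also have "\<dots> = cis (\<theta> * (1 - w)) * (of_real (Gamma (1 - w)) * (- cis \<theta>) powr (- of_real (1 - w)))"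
    using has_bochner_integral_Gamma_complex_scaled[OF _ Re, of "1 - w"] assms
    by (intro has_bochner_integral_integral_eq has_bochner_integral_mult_right) simp
  also have "(- cis \<theta>) powr (- of_real (1 - w)) = cis ((\<theta> - pi) * (w - 1))"
    using ln by (auto simp add: powr_def cis_conv_exp mult_ac)
  also have "cis (\<theta> * (1 - w)) * (of_real (Gamma (1 - w)) * cis ((\<theta> - pi) * (w - 1))) = of_real (Gamma (1 - w)) * cis (pi * (1 - w))"
    by (simp add: cis_mult mult_ac) (simp add: algebra_simps)
  also have "Im (of_real (Gamma (1 - w)) * cis (pi * (1 - w))) = Gamma (1 - w) * sin (pi * w)"
    by (simp add: algebra_simps sin_diff)
  also have "\<dots> = pi * rGamma w"
  proof -
    have "complex_of_real (rGamma w * rGamma (1 - w)) = complex_of_real (sin (pi * w) / pi)"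
      using rGamma_reflection_complex[of "of_real w"]
      by (simp only: of_real_mult of_real_divide rGamma_complex_of_real[symmetric] sin_of_real[symmetric] of_real_diff of_real_1)
    hence "rGamma w * rGamma (1 - w) = sin (pi * w) / pi" by (simp only: of_real_eq_iff)
    hence "sin (pi * w) = pi * (rGamma w * rGamma (1 - w))" by simp
    hence "Gamma (1 - w) * sin (pi * w) = pi * rGamma w * (Gamma (1 - w) * rGamma (1 - w))"
      by (simp only: mult_ac)
    moreover have "Gamma (1 - w) > 0" using assms by (intro Gamma_real_pos) auto
    hence "Gamma (1 - w) * rGamma (1 - w) = 1" by (simp add: rGamma_inverse_Gamma)
    ultimately show ?thesis by simp
  qed
  finally show ?thesis .
qed

text \<open>By the shift lemma the imaginary part is the same for all vertices in
  \<open>(0, 1]\<close>; dominated convergence moves the vertex to the origin, where the value is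
  known.\<close>

lemma hankel_functional_powr_less_1:
  fixes w :: real
  assumes "0 < w" "w < 1"
  shows "hankel_functional (\<lambda>u. u powr (of_real (- w))) = rGamma w"
proof -
  define c where "c n = 1 / (real n + 2)" for n
  have c: "0 < c n" "c n < 1" for n by (auto simp: c_def)
  have c_lim: "c \<longlonglongrightarrow> 0" unfolding c_def by real_asymp
  define s where "s c r = indicator {0..} r *\<^sub>R (exp (hankel_ray \<theta> c r) * cis \<theta> * hankel_ray \<theta> c r powr (of_real (- w)))" for c r
  \<comment> \<open>The majorant combines \<open>c n < 1\<close> in the exponential with
    \<open>norm (hankel_ray \<theta> c r) \<ge> r * sin \<theta>\<close> in the power;
    \<open>w < 1\<close> makes it integrable at 0.\<close>
  define d where "d r = exp 1 * (sin \<theta>) powr (- w) * (indicator {0<..} r *\<^sub>R (r powr ((1 - w) - 1) * exp (- (- cos \<theta> * r))))" for r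
  have "(\<lambda>n. integral\<^sup>L lborel (s (c n))) \<longlonglongrightarrow> integral\<^sup>L lborel (s 0)"
  proof (rule integral_dominated_convergence)
    have "0 < 1 - w" "0 < - cos \<theta>" using assms cos_neg by auto
    thus "integrable lborel d"
      unfolding d_def by (intro integrable_mult_right) (rule has_bochner_integral_Gamma_scaled[THEN integrable.intros])
    show "s (c n) \<in> borel_measurable lborel" for n
      unfolding s_def using c[of n] by measurable
    have "AE r in lborel. r \<noteq> (0::real)" by (rule AE_lborel_singleton)
    thus lim: "AE r in lborel. (\<lambda>n. s (c n) r) \<longlonglongrightarrow> s 0 r"
    proof eventually_elim
      case (elim r)
      have "(\<lambda>n. hankel_ray \<theta> (c n) r) \<longlonglongrightarrow> of_real 0 + of_real r * cis \<theta>"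
        unfolding hankel_ray_def by (intro tendsto_intros c_lim)
      hence l: "(\<lambda>n. hankel_ray \<theta> (c n) r) \<longlonglongrightarrow> hankel_ray \<theta> 0 r" by (simp add: hankel_ray_def)
      show ?case unfolding s_def
        using hankel_ray_not_nonpos[of 0 r] hankel_ray_nonzero[of 0 r] elim
        by (intro tendsto_intros l) auto
    qed
    show "AE r in lborel. norm (s (c n) r) \<le> d r" for n
      using AE_lborel_singleton[of 0]
    proof eventually_elim
      case (elim r)
      show ?case
      proof (cases "r > 0")
        case True
        have "norm (hankel_ray \<theta> (c n) r powr of_real (- w)) = norm (hankel_ray \<theta> (c n) r) powr (- w)"
          by (subst norm_powr_real_powr') auto
        also have "\<dots> \<le> (r * sin \<theta>) powr (- w)"
          using norm_hankel_ray_ge_radius[of r "c n"] True assms sin_pos by (intro powr_mono2') auto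
        also have "\<dots> = (sin \<theta>) powr (- w) * r powr (- w)"
          using True sin_pos by (simp add: powr_mult)
        finally have "norm (s (c n) r) \<le> exp (c n + r * cos \<theta>) * ((sin \<theta>) powr (- w) * r powr (- w))"
          using True unfolding s_def norm_scaleR norm_mult norm_exp_hankel_ray by simp
        also have "\<dots> \<le> exp (1 + r * cos \<theta>) * ((sin \<theta>) powr (- w) * r powr (- w))"
          using c[of n] by (intro mult_right_mono) auto
        also have "\<dots> = d r" using True by (simp add: d_def exp_add mult_ac)
        finally show ?thesis .
      qed (use elim in \<open>auto simp: s_def d_def\<close>)
    qed
    \<comment> \<open>The limit ray meets the origin, so measurability comes from continuity on the
      open half-line; at \<open>r = 0\<close> the integrand is \<open>0\<close> because
      \<open>0 powr y\<close> is.\<close>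
    have "continuous_on {0<..} (\<lambda>r. exp (hankel_ray \<theta> 0 r) * cis \<theta> * hankel_ray \<theta> 0 r powr (of_real (- w)))"
    proof (intro continuous_intros continuous_on_powr_complex)
      show "{0<..} \<subseteq> {r. 0 \<le> Re (hankel_ray \<theta> 0 r) \<or> Im (hankel_ray \<theta> 0 r) \<noteq> 0}"
        using sin_pos by (auto simp: hankel_ray_def)
      show "0 < Re (of_real (- w))" if "r \<in> {0<..}" "hankel_ray \<theta> 0 r = 0" for r
        using that hankel_ray_nonzero[of 0 r] by auto
    qed
    hence "(\<lambda>r. indicator {0<..} r *\<^sub>R (exp (hankel_ray \<theta> 0 r) * cis \<theta> * hankel_ray \<theta> 0 r powr (of_real (- w))))
      \<in> borel_measurable borel"
      by (intro borel_measurable_continuous_on_indicator) auto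
    also have "(\<lambda>r. indicator {0<..} r *\<^sub>R (exp (hankel_ray \<theta> 0 r) * cis \<theta> * hankel_ray \<theta> 0 r powr (of_real (- w))))
      = s 0"
      by (auto simp: s_def fun_eq_iff hankel_ray_def indicator_def)
    finally show "s 0 \<in> borel_measurable lborel" by simp
  qed
  hence "(\<lambda>n. Im (integral\<^sup>L lborel (s (c n)))) \<longlonglongrightarrow> Im (integral\<^sup>L lborel (s 0))"
    by (intro tendsto_intros)
  moreover have "Im (integral\<^sup>L lborel (s (c n))) = Im (integral\<^sup>L lborel (s 1))" for n
    using Im_hankel_integral_shift[OF assms(1) c] by (simp add: s_def[abs_def] set_lebesgue_integral_def)
  ultimately have "Im (integral\<^sup>L lborel (s 1)) = Im (integral\<^sup>L lborel (s 0))"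
    by (simp add: LIMSEQ_const_iff)
  also have "\<dots> = pi * rGamma w"
    using Im_hankel_integral_at_zero[OF assms] by (simp add: s_def[abs_def] set_lebesgue_integral_def)
  finally show ?thesis
    by (simp add: hankel_functional_def s_def[abs_def] set_lebesgue_integral_def)
qed

text \<open>The recurrence links \<open>1\<close> only to other integers, so this value is found as
  the limit of the values at \<open>v n < 1\<close>, using continuity of
  \<open>rGamma\<close>.\<close>

lemma hankel_functional_powr_1:
  "hankel_functional (\<lambda>u. u powr (of_real (- 1))) = rGamma 1"
proof -
  define v where "v n = 1 - 1 / (real n + 2)" for n
  have v: "0 < v n" "v n < 1" for n by (auto simp: v_def)
  have v_lim: "v \<longlonglongrightarrow> 1" unfolding v_def by real_asymp
  define s where "s w r = indicator {0..} r *\<^sub>R (exp (hankel_ray \<theta> 1 r) * cis \<theta> * hankel_ray \<theta> 1 r powr (of_real (- w)))" for w r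
  define d where "d r = max 1 (1 / sin \<theta>) * (indicator {0..} r *\<^sub>R exp (1 + r * cos \<theta>))" for r
  have "(\<lambda>n. integral\<^sup>L lborel (s (v n))) \<longlonglongrightarrow> integral\<^sup>L lborel (s 1)"
  proof (rule integral_dominated_convergence)
    have "integrable lborel (\<lambda>r. exp 1 * (indicator {0..} r *\<^sub>R exp (- (- cos \<theta> * r))))"
      using set_integrable_exp_minus[of "- cos \<theta>"] cos_neg
      by (intro integrable_mult_right) (simp add: set_integrable_def)
    thus "integrable lborel d"
      unfolding d_def by (intro integrable_mult_right) (simp add: exp_add mult_ac)
    show "s (v n) \<in> borel_measurable lborel" for n
      unfolding s_def by measurable
    show "s 1 \<in> borel_measurable lborel"
      unfolding s_def by measurable
    show "AE r in lborel. (\<lambda>n. s (v n) r) \<longlonglongrightarrow> s 1 r"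
    proof (rule AE_I2)
      fix r
      have nz: "hankel_ray \<theta> 1 r \<noteq> 0" by (rule hankel_ray_nonzero) simp
      have "(\<lambda>n. exp (of_real (- v n) * Ln (hankel_ray \<theta> 1 r))) \<longlonglongrightarrow> exp (of_real (- 1) * Ln (hankel_ray \<theta> 1 r))"
        by (intro tendsto_intros v_lim)
      hence "(\<lambda>n. hankel_ray \<theta> 1 r powr of_real (- v n)) \<longlonglongrightarrow> hankel_ray \<theta> 1 r powr of_real (- 1)"
        using nz by (simp only: powr_def if_False)
      thus "(\<lambda>n. s (v n) r) \<longlonglongrightarrow> s 1 r"
        unfolding s_def by (intro tendsto_scaleR tendsto_mult tendsto_const)
    qed
    show "AE r in lborel. norm (s (v n) r) \<le> d r" for n
    proof (rule AE_I2)
      fix r :: real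
      show "norm (s (v n) r) \<le> d r"
      proof (cases "r \<ge> 0")
        case True
        have "norm (hankel_ray \<theta> 1 r powr of_real (- v n)) = norm (hankel_ray \<theta> 1 r) powr (- v n)"
          by (subst norm_powr_real_powr') auto
        also have "\<dots> \<le> (sin \<theta>) powr (- v n)"
          using norm_hankel_ray_ge_base[of 1 r] v[of n] sin_pos by (intro powr_mono2') auto
        \<comment> \<open>Since \<open>sin \<theta> \<le> 1\<close>, lowering the exponent from
          \<open>- v n\<close> to \<open>- 1\<close> enlarges the power, and the bound becomes
          uniform in \<open>n\<close>.\<close>
        also have "\<dots> \<le> sin \<theta> powr (- 1)"
          using v[of n] sin_pos by (intro powr_mono') auto
        also have "\<dots> \<le> max 1 (1 / sin \<theta>)"
          using sin_pos by (simp add: powr_minus field_simps)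
        finally have "exp (1 + r * cos \<theta>) * norm (hankel_ray \<theta> 1 r powr of_real (- v n)) \<le>
            exp (1 + r * cos \<theta>) * max 1 (1 / sin \<theta>)"
          by (intro mult_left_mono) auto
        thus ?thesis using True unfolding s_def d_def norm_scaleR norm_mult norm_exp_hankel_ray by (simp add: mult_ac)
      qed (auto simp: s_def d_def)
    qed
  qed
  hence "(\<lambda>n. Im (integral\<^sup>L lborel (s (v n))) / pi) \<longlonglongrightarrow> Im (integral\<^sup>L lborel (s 1)) / pi"
    by (intro tendsto_intros) auto
  also have "(\<lambda>n. Im (integral\<^sup>L lborel (s (v n))) / pi) = (\<lambda>n. rGamma (v n))"
    using hankel_functional_powr_less_1[OF v]
    by (simp add: hankel_functional_def s_def[abs_def] set_lebesgue_integral_def)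
  finally have "(\<lambda>n. rGamma (v n)) \<longlonglongrightarrow> Im (integral\<^sup>L lborel (s 1)) / pi" .
  moreover have "(\<lambda>n. rGamma (v n)) \<longlonglongrightarrow> rGamma 1"
    using continuous_on_rGamma[of "UNIV :: real set"] v_lim
    by (intro isCont_tendsto_compose[of 1 rGamma]) (simp_all add: continuous_on_eq_continuous_at)
  ultimately have "Im (integral\<^sup>L lborel (s 1)) / pi = rGamma 1"
    by (rule LIMSEQ_unique)
  thus ?thesis
    by (simp add: hankel_functional_def s_def[abs_def] set_lebesgue_integral_def)
qed

text \<open>Both sides satisfy the same recurrence, so agreement on \<open>(0, 1]\<close> spreads to
  the positive axis and then to all real \<open>w\<close>.\<close>

theorem hankel_functional_powr:
  fixes w :: real
  shows "hankel_functional (\<lambda>u. u powr (of_real (- w))) = rGamma w"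
proof -
  have up: "hankel_functional (\<lambda>u. u powr (of_real (- (w + real n)))) = rGamma (w + real n)" if "0 < w" "w \<le> 1" for w n
  proof (induction n)
    case 0
    thus ?case using hankel_functional_powr_less_1[of w] hankel_functional_powr_1 that by (cases "w = 1") auto
  next
    case (Suc n)
    have "(w + real n) * hankel_functional (\<lambda>u. u powr (of_real (- (w + real n + 1)))) = (w + real n) * rGamma (w + real n + 1)"
      using Suc hankel_functional_powr_rec[of "w + real n"] rGamma_plus1[of "w + real n"] by linarith
    moreover have "w + real n \<noteq> 0" using that by auto
    ultimately have "hankel_functional (\<lambda>u. u powr (of_real (- (w + real n + 1)))) = rGamma (w + real n + 1)"
      using mult_left_cancel by blast
    moreover have "w + real (Suc n) = w + real n + 1" by simp
    ultimately show ?case by (simp only:)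
  qed
  have pos: "hankel_functional (\<lambda>u. u powr (of_real (- w))) = rGamma w" if "0 < w" for w :: real
  proof -
    \<comment> \<open>The ceiling minus 1 places \<open>w - n\<close> in the half-open interval
      \<open>(0, 1]\<close>, with integers landing on \<open>1\<close>.\<close>
    define n where "n = nat (\<lceil>w\<rceil> - 1)"
    have "real n = of_int \<lceil>w\<rceil> - 1" using that by (simp add: n_def)
    hence "0 < w - real n" "w - real n \<le> 1" by linarith+
    from up[OF this, of n] show ?thesis by simp
  qed
  \<comment> \<open>Downward the recurrence only multiplies, so it passes through the zeros of
    \<open>rGamma\<close> at the nonpositive integers.\<close>
  have down: "hankel_functional (\<lambda>u. u powr (of_real (- (w - real n)))) = rGamma (w - real n)" if "0 < w" for w n
  proof (induction n)
    case 0
    thus ?case using pos[OF that] by simp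
  next
    case (Suc n)
    moreover have "w - real (Suc n) + 1 = w - real n" by simp
    ultimately show ?case
      using hankel_functional_powr_rec[of "w - real (Suc n)"] rGamma_plus1[of "w - real (Suc n)"]
      by metis
  qed
  obtain n where "- w < real n" using reals_Archimedean2 by blast
  hence "0 < w + real n" by simp
  from down[OF this, of n] show ?thesis by simp
qed

section \<open>The Wright function as a contour integral\<close>

text \<open>Common majorant for the termwise integration of the exponential series and for the
  exchange of integrals in the transform.\<close>

lemma integrable_hankel_dominator:
  fixes K \<kappa> :: real
  assumes "0 \<le> K" "0 \<le> \<kappa>" "\<kappa> < 1"
  shows "integrable lborel (\<lambda>r. indicator {0..} r * (exp (1 + r * cos \<theta>) * exp (K * (1 + r) powr \<kappa>)))"
proof -
  have "set_integrable lborel {0..} (\<lambda>r. exp (hankel_ray \<theta> 1 r) * cis \<theta> * of_real (exp (K * (1 + r) powr \<kappa>)))"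
    using assms by (intro set_integrable_hankel[of _ K \<kappa> 1]) auto
  hence "integrable lborel (\<lambda>r. norm (indicator {0..} r *\<^sub>R
     (exp (hankel_ray \<theta> 1 r) * cis \<theta> * complex_of_real (exp (K * (1 + r) powr \<kappa>)))))"
    unfolding set_integrable_def by (rule integrable_norm)
  thus ?thesis
    unfolding norm_scaleR norm_mult norm_exp_hankel_ray by (simp add: mult_ac)
qed

lemma set_integrable_hankel_exp:
  fixes \<rho> z :: real
  assumes "\<bar>\<rho>\<bar> < 1"
  shows "set_integrable lborel {0..} (\<lambda>r. exp (hankel_ray \<theta> 1 r) * cis \<theta> *
    exp (of_real z * hankel_ray \<theta> 1 r powr (of_real (- \<rho>))))"
proof -
  obtain C where C: "0 \<le> C" "\<And>r. 0 \<le> r \<Longrightarrow> norm (hankel_ray \<theta> 1 r) powr (- \<rho>) \<le> C * (1 + r) powr \<bar>- \<rho>\<bar>"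
    using norm_hankel_ray_powr_le[of 1] by (metis zero_less_one)
  show ?thesis
  proof (rule set_integrable_hankel[of _ "\<bar>z\<bar> * C" "\<bar>\<rho>\<bar>" 1])
    fix r :: real assume r: "0 \<le> r"
    have "norm (of_real z * hankel_ray \<theta> 1 r powr (of_real (- \<rho>))) = \<bar>z\<bar> * norm (hankel_ray \<theta> 1 r) powr (- \<rho>)"
      unfolding norm_mult by (subst norm_powr_real_powr') auto
    also have "\<dots> \<le> \<bar>z\<bar> * C * (1 + r) powr \<bar>\<rho>\<bar>"
      using mult_left_mono[OF C(2)[OF r], of "\<bar>z\<bar>"] by (simp add: mult_ac)
    finally have "exp (norm (of_real z * hankel_ray \<theta> 1 r powr (of_real (- \<rho>)))) \<le> exp (\<bar>z\<bar> * C * (1 + r) powr \<bar>\<rho>\<bar>)"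
      by (rule exp_le_cancel_iff[THEN iffD2])
    from order_trans[OF norm_exp this]
    show "norm (exp (of_real z * hankel_ray \<theta> 1 r powr (of_real (- \<rho>)))) \<le> 1 * exp (\<bar>z\<bar> * C * (1 + r) powr \<bar>\<rho>\<bar>)"
      by (simp only: mult_1)
  qed (use assms C(1) in auto)
qed

text \<open>Hankel's formula applied term by term. The partial sums are bounded by the exponential
  of the norm, which grows with exponent \<open>\<bar>\<rho>\<bar> < 1\<close> and loses to the
  decay of \<open>exp\<close> on the ray.\<close>

lemma sums_hankel_functional_exp:
  fixes \<rho> z :: real
  assumes "\<bar>\<rho>\<bar> < 1"
  shows "(\<lambda>n. z ^ n / fact n * rGamma (\<rho> * real n)) sums
     hankel_functional (\<lambda>u. exp (of_real z * u powr (of_real (- \<rho>))))"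
proof -
  define E where "E r = exp (hankel_ray \<theta> 1 r) * cis \<theta>" for r
  define f where "f n r = (indicator {0..} r *\<^sub>R (E r * hankel_ray \<theta> 1 r powr of_real (- (\<rho> * real n)))) * of_real (z ^ n / fact n)" for n r
  define l where "l r = indicator {0..} r *\<^sub>R (E r * exp (of_real z * hankel_ray \<theta> 1 r powr of_real (- \<rho>)))" for r
  obtain C where C: "0 \<le> C" "\<And>r. 0 \<le> r \<Longrightarrow> norm (hankel_ray \<theta> 1 r) powr (- \<rho>) \<le> C * (1 + r) powr \<bar>- \<rho>\<bar>"
    using norm_hankel_ray_powr_le[of 1] by (metis zero_less_one)
  define d where "d r = indicator {0..} r * (exp (1 + r * cos \<theta>) * exp (\<bar>z\<bar> * C * (1 + r) powr \<bar>\<rho>\<bar>))" for r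
  \<comment> \<open>Integer powers respect the principal branch, so no condition on the argument
    arises.\<close>
  have powr_n: "hankel_ray \<theta> 1 r powr of_real (- (\<rho> * real n)) = (hankel_ray \<theta> 1 r powr of_real (- \<rho>)) ^ n" for r n
    using hankel_ray_nonzero[of 1 r] by (simp add: powr_def mult_ac flip: exp_of_nat_mult)
  have f_eq: "f n r = indicator {0..} r *\<^sub>R (E r * ((of_real z * hankel_ray \<theta> 1 r powr of_real (- \<rho>)) ^ n /\<^sub>R fact n))" for n r
    unfolding f_def powr_n by (simp add: power_mult_distrib scaleR_conv_of_real field_simps)
  have int_f: "integrable lborel (f n)" for n
    unfolding f_def using set_integrable_hankel_powr[of 1 "- (\<rho> * real n)"]
    by (intro integrable_mult_left) (simp add: set_integrable_def E_def)
  have lim: "(\<lambda>N. \<Sum>n<N. f n r) \<longlonglongrightarrow> l r" for r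
    using exp_converges[of "of_real z * hankel_ray \<theta> 1 r powr of_real (- \<rho>)"]
    unfolding sums_def f_eq l_def sum_distrib_left[symmetric] scaleR_sum_right[symmetric]
    by (intro tendsto_scaleR tendsto_mult tendsto_const)
  have "(\<lambda>N. integral\<^sup>L lborel (\<lambda>r. \<Sum>n<N. f n r)) \<longlonglongrightarrow> integral\<^sup>L lborel l"
  proof (rule integral_dominated_convergence)
    show meas: "(\<lambda>r. \<Sum>n<N. f n r) \<in> borel_measurable lborel" for N
      using int_f by (intro borel_measurable_sum) (rule borel_measurable_integrable)
    show "l \<in> borel_measurable lborel"
      unfolding l_def E_def by measurable
    show "integrable lborel d"
      unfolding d_def using assms C(1) by (intro integrable_hankel_dominator) auto
    show "AE r in lborel. (\<lambda>N. \<Sum>n<N. f n r) \<longlonglongrightarrow> l r" using lim by simp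
    show "AE r in lborel. norm (\<Sum>n<N. f n r) \<le> d r" for N
    proof (rule AE_I2)
      fix r :: real
      show "norm (\<Sum>n<N. f n r) \<le> d r"
      proof (cases "r \<ge> 0")
        case True
        define y where "y = norm (of_real z * hankel_ray \<theta> 1 r powr of_real (- \<rho>))"
        have "norm (\<Sum>n<N. f n r) \<le> (\<Sum>n<N. norm (f n r))" by (rule norm_sum)
        also have "\<dots> = exp (1 + r * cos \<theta>) * (\<Sum>n<N. y ^ n /\<^sub>R fact n)"
          unfolding sum_distrib_left f_eq E_def norm_scaleR norm_mult norm_exp_hankel_ray norm_power y_def
          using True by (simp add: mult_ac)
        also have "(\<Sum>n<N. y ^ n /\<^sub>R fact n) \<le> exp y"
          unfolding exp_def
          by (rule sum_le_suminf) (use summable_exp_generic[of y] in \<open>auto simp: y_def\<close>)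
        also have "y \<le> \<bar>z\<bar> * C * (1 + r) powr \<bar>\<rho>\<bar>"
        proof -
          have "y = \<bar>z\<bar> * norm (hankel_ray \<theta> 1 r) powr (- \<rho>)"
            unfolding y_def norm_mult by (subst norm_powr_real_powr') auto
          thus ?thesis using C(2)[OF True] mult_left_mono[OF C(2)[OF True], of "\<bar>z\<bar>"] by (simp add: mult_ac)
        qed
        finally show ?thesis using True by (simp add: d_def)
      qed (auto simp: f_def d_def)
    qed
  qed
  also have "(\<lambda>N. integral\<^sup>L lborel (\<lambda>r. \<Sum>n<N. f n r)) = (\<lambda>N. \<Sum>n<N. integral\<^sup>L lborel (f n))"
    using int_f by (intro ext Bochner_Integration.integral_sum) auto
  finally have "(\<lambda>n. integral\<^sup>L lborel (f n)) sums integral\<^sup>L lborel l" by (simp add: sums_def)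
  hence "(\<lambda>n. Im (integral\<^sup>L lborel (f n)) / pi) sums (Im (integral\<^sup>L lborel l) / pi)"
    by (intro sums_divide sums_Im)
  also have "Im (integral\<^sup>L lborel l) / pi = hankel_functional (\<lambda>u. exp (of_real z * u powr (of_real (- \<rho>))))"
    by (simp add: hankel_functional_def l_def[abs_def] E_def set_lebesgue_integral_def)
  also have "(\<lambda>n. Im (integral\<^sup>L lborel (f n)) / pi) = (\<lambda>n. z ^ n / fact n * rGamma (\<rho> * real n))"
  proof
    fix n
    have "integral\<^sup>L lborel (f n) = (LINT r:{0..}|lborel. exp (hankel_ray \<theta> 1 r) * cis \<theta> *
       hankel_ray \<theta> 1 r powr of_real (- (\<rho> * real n))) * of_real (z ^ n / fact n)"
      unfolding f_def E_def set_lebesgue_integral_def by (rule integral_mult_left_zero)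
    hence "Im (integral\<^sup>L lborel (f n)) / pi = z ^ n / fact n *
       hankel_functional (\<lambda>u. u powr (of_real (- (\<rho> * real n))))"
      unfolding hankel_functional_def by (simp del: of_real_divide of_real_power of_real_mult of_real_minus)
    thus "Im (integral\<^sup>L lborel (f n)) / pi = z ^ n / fact n * rGamma (\<rho> * real n)"
      by (simp only: hankel_functional_powr)
  qed
  finally show ?thesis .
qed

lemma reduced_wright_eq_hankel_functional:
  fixes \<rho> z :: real
  assumes "\<bar>\<rho>\<bar> < 1"
  shows "reduced_wright \<rho> z = hankel_functional (\<lambda>u. exp (of_real z * u powr (of_real (- \<rho>))))"
proof -
  have "(\<lambda>n. z ^ Suc n / fact (Suc n) * rGamma (\<rho> * real (Suc n))) sums
     hankel_functional (\<lambda>u. exp (of_real z * u powr (of_real (- \<rho>))))"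
    \<comment> \<open>The term of index 0 is \<open>rGamma 0 = 0\<close>, so the shift of the index
      leaves the sum unchanged.\<close>
    using sums_hankel_functional_exp[OF assms, of z] by (subst sums_Suc_iff) simp
  thus ?thesis unfolding reduced_wright_def by (rule sums_unique[symmetric])
qed

section \<open>Arguments and real parts of powers on the ray\<close>

text \<open>Rotation by \<open>cis (- \<theta>)\<close> sends every point of the ray to imaginary
  part \<open>- sin \<theta> < 0\<close>, which rules out an argument above
  \<open>\<theta>\<close>.\<close>

lemma Arg_hankel_ray:
  assumes "0 \<le> r"
  shows "0 \<le> Arg (hankel_ray \<theta> 1 r)" "Arg (hankel_ray \<theta> 1 r) \<le> \<theta>"
proof -
  let ?g = "hankel_ray \<theta> 1 r"
  have nz: "?g \<noteq> 0" by (rule hankel_ray_nonzero) simp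
  have "0 \<le> Im ?g" using assms sin_pos by (simp add: hankel_ray_def)
  thus nonneg: "0 \<le> Arg ?g" using Arg_less_0 not_le by blast
  show "Arg ?g \<le> \<theta>"
  proof (rule ccontr)
    assume "\<not> ?thesis"
    hence "0 < sin (Arg ?g - \<theta>)"
      using angle_gt pi_gt_zero Arg_le_pi[of ?g] by (intro sin_gt_zero) linarith+
    hence "0 < norm ?g * sin (Arg ?g - \<theta>)" using nz by simp
    also have "norm ?g * sin (Arg ?g - \<theta>) = Im (of_real (norm ?g) * cis (Arg ?g) * cis (- \<theta>))"
      by (simp add: mult.assoc cis_mult)
    also have "of_real (norm ?g) * cis (Arg ?g) = ?g"
      using rcis_cmod_Arg[of ?g] by (simp add: rcis_def)
    also have "Im (?g * cis (- \<theta>)) = - sin \<theta>"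
      by (simp add: hankel_ray_def algebra_simps)
    finally show False using sin_pos by simp
  qed
qed

text \<open>The argument of the power is at most \<open>\<bar>v\<bar> * \<theta>\<close> in modulus,
  so the power stays in a fixed sector of the right half-plane and can serve as a Laplace
  variable.\<close>

lemma Re_hankel_ray_powr_ge:
  fixes v :: real
  assumes "0 \<le> r" "\<bar>v\<bar> * \<theta> < pi / 2"
  shows "cos (\<bar>v\<bar> * \<theta>) * norm (hankel_ray \<theta> 1 r) powr v \<le> Re (hankel_ray \<theta> 1 r powr of_real v)"
proof -
  let ?g = "hankel_ray \<theta> 1 r"
  have nz: "?g \<noteq> 0" by (rule hankel_ray_nonzero) simp
  have "\<bar>v * Arg ?g\<bar> \<le> \<bar>v\<bar> * \<theta>"
    using Arg_hankel_ray[OF assms(1)] by (simp add: abs_mult mult_left_mono)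
  hence "cos (\<bar>v\<bar> * \<theta>) \<le> cos \<bar>v * Arg ?g\<bar>"
    using assms pi_gt_zero by (intro cos_monotone_0_pi_le) linarith+
  hence "cos (\<bar>v\<bar> * \<theta>) * norm ?g powr v \<le> cos (v * Arg ?g) * norm ?g powr v"
    by (intro mult_right_mono) auto
  also have "cos (v * Arg ?g) * norm ?g powr v = Re (?g powr of_real v)"
    using nz by (simp add: powr_def Re_exp Arg_eq_Im_Ln mult_ac)
  finally show ?thesis .
qed

end

subsection \<open>The Bessel kernel\<close>

text \<open>The power series treats the \<open>I\<close> and \<open>J\<close> kernels at once
  through the sign of \<open>z\<close> and avoids square roots.\<close>

definition bessel_kernel :: "real \<Rightarrow> real \<Rightarrow> real" where
  "bessel_kernel z s = (\<Sum>k. z ^ Suc k * s ^ k / (fact k * fact (Suc k)))"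

lemma summable_norm_bessel_kernel:
  "summable (\<lambda>k. norm (z ^ Suc k * s ^ k / (fact k * fact (Suc k)) :: real))"
proof (rule summable_comparison_test')
  show "summable (\<lambda>k. \<bar>z\<bar> * (\<bar>z * s\<bar> ^ k /\<^sub>R fact k))"
    by (intro summable_mult summable_exp_generic)
  fix k :: nat
  have "\<bar>z\<bar> * \<bar>z * s\<bar> ^ k / (fact k * fact (Suc k)) \<le> \<bar>z\<bar> * \<bar>z * s\<bar> ^ k / (fact k * 1)"
    by (intro divide_left_mono mult_left_mono fact_ge_1) auto
  thus "norm (norm (z ^ Suc k * s ^ k / (fact k * fact (Suc k)))) \<le> \<bar>z\<bar> * (\<bar>z * s\<bar> ^ k /\<^sub>R fact k)"
    by (simp add: abs_mult power_abs power_mult_distrib divide_inverse mult_ac del: fact_Suc)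
qed

lemma sums_bessel_kernel:
  "(\<lambda>k. z ^ Suc k * s ^ k / (fact k * fact (Suc k))) sums bessel_kernel z s"
  unfolding bessel_kernel_def
  by (intro summable_sums summable_norm_cancel[OF summable_norm_bessel_kernel])

lemma abs_bessel_kernel_le:
  assumes "0 \<le> s"
  shows "\<bar>bessel_kernel z s\<bar> \<le> bessel_kernel \<bar>z\<bar> s"
proof -
  have "norm (bessel_kernel z s) \<le> (\<Sum>k. norm (z ^ Suc k * s ^ k / (fact k * fact (Suc k))))"
    unfolding bessel_kernel_def by (rule summable_norm[OF summable_norm_bessel_kernel])
  also have "\<dots> = bessel_kernel \<bar>z\<bar> s"
    using assms by (simp add: bessel_kernel_def abs_mult power_abs)
  finally show ?thesis by simp
qed

lemma borel_measurable_bessel_kernel [measurable]: "bessel_kernel z \<in> borel_measurable borel"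
  unfolding bessel_kernel_def[abs_def] by measurable

text \<open>The Laplace transform of \<open>s ^ k\<close> is \<open>fact k / u ^ Suc k\<close>; the
  factor \<open>fact k\<close> cancels and leaves the exponential series without its first term. The
  norms sum to the same series at \<open>\<bar>z\<bar> / Re u\<close>.\<close>

lemma has_bochner_integral_bessel_kernel:
  fixes u :: complex and z :: real
  assumes "0 < Re u"
  shows "has_bochner_integral lborel
    (\<lambda>s. indicator {0<..} s *\<^sub>R (exp (- (u * of_real s)) * of_real (bessel_kernel z s)))
    (exp (of_real z / u) - 1)"
proof -
  define f where "f k s = indicator {0<..} s *\<^sub>R (exp (- (u * of_real s)) *
     of_real (z ^ Suc k * s ^ k / (fact k * fact (Suc k))))" for k s
  have nz: "u \<noteq> 0" using assms by auto
  have pw: "s powr (real (Suc k) - 1) = s ^ k" if "s > 0" for s k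
    using that by (simp add: powr_realpow)
  have int_f: "has_bochner_integral lborel (f k) ((of_real z / u) ^ Suc k / fact (Suc k))" for k
  proof -
    have "has_bochner_integral lborel
      (\<lambda>s. of_real (z ^ Suc k / (fact k * fact (Suc k))) *
         (indicator {0<..} s *\<^sub>R (of_real (s powr (real (Suc k) - 1)) * exp (- (u * of_real s)))))
      (of_real (z ^ Suc k / (fact k * fact (Suc k))) *
         (of_real (Gamma (real (Suc k))) * u powr (- of_real (real (Suc k)))))"
      using assms by (intro has_bochner_integral_mult_right has_bochner_integral_Gamma_complex_scaled) auto
    also have "(\<lambda>s. of_real (z ^ Suc k / (fact k * fact (Suc k))) *
         (indicator {0<..} s *\<^sub>R (of_real (s powr (real (Suc k) - 1)) * exp (- (u * of_real s))))) = f k"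
    proof
      fix s
      show "of_real (z ^ Suc k / (fact k * fact (Suc k))) *
         (indicator {0<..} s *\<^sub>R (of_real (s powr (real (Suc k) - 1)) * exp (- (u * of_real s)))) = f k s"
        by (cases "s > 0") (simp_all only: pw f_def, simp_all)
    qed
    also have "u powr (- of_real (real (Suc k))) = inverse u ^ Suc k"
    proof -
      have "u powr (- of_real (real (Suc k))) = inverse (u powr of_nat (Suc k))"
        by (simp only: powr_minus of_real_of_nat_eq)
      also have "u powr of_nat (Suc k) = u ^ Suc k"
        using nz by (simp only: powr_nat' simp_thms)
      finally show ?thesis by (simp only: power_inverse)
    qed
    also have "Gamma (real (Suc k)) = fact k"
      using Gamma_fact[of k, where 'a = real] by (simp add: add.commute)
    also have "of_real (z ^ Suc k / (fact k * fact (Suc k))) * (of_real (fact k) * inverse u ^ Suc k)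
       = (of_real z / u) ^ Suc k / fact (Suc k)"
      by (simp add: power_divide field_simps del: fact_Suc)
    finally show ?thesis .
  qed
  have int_nf: "has_bochner_integral lborel (\<lambda>s. norm (f k s)) ((\<bar>z\<bar> / Re u) ^ Suc k / fact (Suc k))" for k
  proof -
    have "has_bochner_integral lborel
      (\<lambda>s. \<bar>z\<bar> ^ Suc k / (fact k * fact (Suc k)) *
         (indicator {0<..} s *\<^sub>R (s powr (real (Suc k) - 1) * exp (- (Re u * s)))))
      (\<bar>z\<bar> ^ Suc k / (fact k * fact (Suc k)) *
         (Gamma (real (Suc k)) * Re u powr (- real (Suc k))))"
      using assms by (intro has_bochner_integral_mult_right has_bochner_integral_Gamma_scaled) auto
    also have "(\<lambda>s. \<bar>z\<bar> ^ Suc k / (fact k * fact (Suc k)) *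
         (indicator {0<..} s *\<^sub>R (s powr (real (Suc k) - 1) * exp (- (Re u * s))))) = (\<lambda>s. norm (f k s))"
    proof
      fix s
      show "\<bar>z\<bar> ^ Suc k / (fact k * fact (Suc k)) *
         (indicator {0<..} s *\<^sub>R (s powr (real (Suc k) - 1) * exp (- (Re u * s)))) = norm (f k s)"
        by (cases "s > 0") (simp_all only: pw f_def norm_scaleR norm_mult norm_of_real,
            simp_all add: abs_mult power_abs mult_ac del: fact_Suc)
    qed
    also have "Re u powr (- real (Suc k)) = inverse (Re u) ^ Suc k"
      unfolding powr_minus powr_realpow[OF assms] by (simp only: power_inverse)
    also have "Gamma (real (Suc k)) = fact k"
      using Gamma_fact[of k, where 'a = real] by (simp add: add.commute)
    also have "\<bar>z\<bar> ^ Suc k / (fact k * fact (Suc k)) * (fact k * inverse (Re u) ^ Suc k)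
       = (\<bar>z\<bar> / Re u) ^ Suc k / fact (Suc k)"
      by (simp add: power_divide field_simps del: fact_Suc)
    finally show ?thesis .
  qed
  have I: "integrable lborel (f k)" for k using int_f has_bochner_integral_iff by blast
  have "summable (\<lambda>k. norm (f k s))" for s
  proof -
    have "norm (f k s) = indicator {0<..} s * exp (- (Re u * s)) * norm (z ^ Suc k * s ^ k / (fact k * fact (Suc k)))" for k
      unfolding f_def norm_scaleR norm_mult norm_of_real by simp
    thus ?thesis using summable_mult[OF summable_norm_bessel_kernel] by simp
  qed
  hence smf: "AE s in lborel. summable (\<lambda>k. norm (f k s))" by simp
  have "summable (\<lambda>k. (\<bar>z\<bar> / Re u) ^ Suc k /\<^sub>R fact (Suc k))"
    by (subst summable_Suc_iff) (rule summable_exp_generic)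
  hence smi: "summable (\<lambda>k. LINT s|lborel. norm (f k s))"
    using int_nf by (simp add: has_bochner_integral_iff divide_inverse mult_ac)
  have f_sums: "(\<Sum>k. f k s) = indicator {0<..} s *\<^sub>R (exp (- (u * of_real s)) * of_real (bessel_kernel z s))" for s
  proof -
    have "(\<lambda>k. f k s) sums (indicator {0<..} s *\<^sub>R (exp (- (u * of_real s)) * of_real (bessel_kernel z s)))"
      unfolding f_def by (intro sums_scaleR_right sums_mult sums_of_real sums_bessel_kernel)
    thus ?thesis by (rule sums_unique[symmetric])
  qed
  have "(\<lambda>k. integral\<^sup>L lborel (f k)) sums (LINT s|lborel. (\<Sum>k. f k s))"
    by (rule sums_integral[OF I smf smi])
  moreover have "(\<lambda>k. integral\<^sup>L lborel (f k)) sums (exp (of_real z / u) - 1)"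
  proof -
    have "(\<lambda>k. (of_real z / u) ^ Suc k /\<^sub>R fact (Suc k)) sums (exp (of_real z / u) - 1)"
      using exp_converges[of "of_real z / u"] by (subst sums_Suc_iff) simp
    thus ?thesis using int_f
      by (simp add: has_bochner_integral_iff scaleR_conv_of_real divide_inverse mult_ac)
  qed
  ultimately have "(LINT s|lborel. (\<Sum>k. f k s)) = exp (of_real z / u) - 1"
    by (rule sums_unique2)
  with integrable_suminf[OF I smf smi] show ?thesis
    by (simp add: has_bochner_integral_iff f_sums)
qed

section \<open>Link with the Bessel functions\<close>

lemma bessel_prefactor:
  fixes x s :: real
  assumes "0 < x" "0 < s"
  shows "sqrt x * s powr (- (1/2)) * (2 * sqrt (x * s) / 2) ^ (2 * k + 1) = x ^ Suc k * s ^ k"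
proof -
  have "(2 * sqrt (x * s) / 2) ^ (2 * k + 1) = sqrt (x * s) * (x * s) ^ k"
    using assms by (simp add: power_mult)
  moreover have "sqrt x * s powr (- (1/2)) * sqrt (x * s) = x"
    using assms by (simp add: powr_minus powr_half_sqrt real_sqrt_mult field_simps)
  ultimately show ?thesis
    by (metis mult.assoc power_Suc power_mult_distrib)
qed

lemma bessel_I_1_eq_bessel_kernel:
  assumes "0 < x" "0 < s"
  shows "sqrt x * (s powr (- (1/2)) * bessel_I 1 (2 * sqrt (x * s))) = bessel_kernel x s"
proof -
  define c where "c = sqrt x * s powr (- (1/2))"
  have c: "c \<noteq> 0" using assms by (simp add: c_def)
  have "(\<lambda>k. x ^ Suc k * s ^ k / (fact k * fact (Suc k)) / c) sums (bessel_kernel x s / c)"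
    by (intro sums_divide sums_bessel_kernel)
  also have "(\<lambda>k. x ^ Suc k * s ^ k / (fact k * fact (Suc k)) / c) =
    (\<lambda>k. 1 / (fact k * fact (k + 1)) * (2 * sqrt (x * s) / 2) ^ (2 * k + 1))"
    unfolding bessel_prefactor[OF assms, symmetric] c_def[symmetric]
    using c by (simp add: field_simps del: fact_Suc)
  finally have "bessel_I 1 (2 * sqrt (x * s)) = bessel_kernel x s / c"
    unfolding bessel_I_def by (rule sums_unique[symmetric])
  thus ?thesis using c by (simp add: c_def)
qed

lemma bessel_J_1_eq_bessel_kernel:
  assumes "0 < x" "0 < s"
  shows "sqrt x * (s powr (- (1/2)) * bessel_J 1 (2 * sqrt (x * s))) = - bessel_kernel (- x) s"
proof -
  define c where "c = sqrt x * s powr (- (1/2))"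
  have c: "c \<noteq> 0" using assms by (simp add: c_def)
  have "(\<lambda>k. - ((- x) ^ Suc k * s ^ k / (fact k * fact (Suc k))) / c) sums (- bessel_kernel (- x) s / c)"
    by (intro sums_divide sums_minus sums_bessel_kernel)
  also have "(\<lambda>k. - ((- x) ^ Suc k * s ^ k / (fact k * fact (Suc k))) / c) =
    (\<lambda>k. (- 1) ^ k / (fact k * fact (k + 1)) * (2 * sqrt (x * s) / 2) ^ (2 * k + 1))"
  proof
    fix k
    \<comment> \<open>The exponent \<open>Suc k\<close> carries one sign more than the alternating
      factor of \<open>bessel_J\<close>, hence the minus sign in the conclusion.\<close>
    have "(- x) ^ Suc k * s ^ k = - ((- 1) ^ k * (x ^ Suc k * s ^ k))"
      by (subst power_minus) simp
    also have "x ^ Suc k * s ^ k = c * (2 * sqrt (x * s) / 2) ^ (2 * k + 1)"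
      unfolding c_def bessel_prefactor[OF assms] by (rule refl)
    finally show "- ((- x) ^ Suc k * s ^ k / (fact k * fact (Suc k))) / c =
      (- 1) ^ k / (fact k * fact (k + 1)) * (2 * sqrt (x * s) / 2) ^ (2 * k + 1)"
      using c by (simp add: field_simps del: fact_Suc)
  qed
  finally have "bessel_J 1 (2 * sqrt (x * s)) = - bessel_kernel (- x) s / c"
    unfolding bessel_J_def by (rule sums_unique[symmetric])
  thus ?thesis using c by (simp add: c_def)
qed

subsection \<open>The integral transform\<close>

lemma ex_hankel_angle:
  fixes \<rho> :: real
  assumes "\<bar>\<rho>\<bar> < 1"
  obtains \<theta> where "hankel_angle \<theta>" "\<bar>\<rho>\<bar> * \<theta> < pi / 2"
proof -
  \<comment> \<open>Any angle strictly between \<open>pi / 2\<close> and both \<open>pi\<close> and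
    \<open>pi / (2 * \<bar>\<rho>\<bar>)\<close> would do; for
    \<open>0 < \<bar>\<rho>\<bar> < 1\<close> this is one.\<close>
  define \<theta> where "\<theta> = pi / (1 + \<bar>\<rho>\<bar>)"
  show ?thesis
  proof (cases "\<rho> = 0")
    case True
    \<comment> \<open>For \<open>\<rho> = 0\<close> the formula would give the excluded angle
      \<open>pi\<close>.\<close>
    have "hankel_angle (3 / 4 * pi)" by unfold_locales auto
    thus ?thesis using True by (intro that) auto
  next
    case False
    have "pi * (1 + \<bar>\<rho>\<bar>) < pi * 2" "pi < pi * (1 + \<bar>\<rho>\<bar>)" "\<bar>\<rho>\<bar> * pi * 2 < pi * (1 + \<bar>\<rho>\<bar>)"
      using assms False by (auto simp: algebra_simps)
    hence "pi / 2 < \<theta>" "\<theta> < pi" "\<bar>\<rho>\<bar> * \<theta> < pi / 2"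
      by (auto simp: \<theta>_def field_simps)
    thus ?thesis by (intro that[of \<theta>]) (auto intro: hankel_angle.intro)
  qed
qed

context hankel_angle
begin

text \<open>Fubini for \<open>f r s\<close>: integrating over \<open>s\<close> first gives the
  Laplace transform of the kernel at \<open>U r\<close>, integrating over \<open>r\<close> first
  gives the Wright function. The angle condition ensures \<open>0 < Re (U r)\<close>.\<close>

lemma reduced_wright_bessel_kernel_transform:
  fixes \<rho> z :: real
  assumes "\<bar>\<rho>\<bar> < 1" "\<bar>\<rho>\<bar> * \<theta> < pi / 2"
  shows "has_bochner_integral lborel
    (\<lambda>s. indicator {0<..} s *\<^sub>R (reduced_wright \<rho> (- s) * bessel_kernel z s)) (reduced_wright (- \<rho>) z)"
proof -
  define E where "E r = exp (hankel_ray \<theta> 1 r) * cis \<theta>" for r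
  define U where "U r = hankel_ray \<theta> 1 r powr (of_real (- \<rho>))" for r
  define f where "f r s = (indicator {0..} r *\<^sub>R E r) *
    (indicator {0<..} s *\<^sub>R (exp (- (U r * of_real s)) * of_real (bessel_kernel z s)))" for r s
  have [measurable]: "E \<in> borel_measurable borel" "U \<in> borel_measurable borel"
    unfolding E_def[abs_def] U_def[abs_def] by measurable
  define b where "b = cos (\<bar>\<rho>\<bar> * \<theta>)"
  have b: "b > 0"
  proof -
    have "0 \<le> \<bar>\<rho>\<bar> * \<theta>" using angle_gt pi_gt_zero by (intro mult_nonneg_nonneg) linarith+
    thus ?thesis unfolding b_def using assms pi_gt_zero by (intro cos_gt_zero_pi) linarith+
  qed
  have norm_pos: "0 < norm (hankel_ray \<theta> 1 r)" for r
    using hankel_ray_nonzero[of 1 r] by simp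
  have U_ge: "b * norm (hankel_ray \<theta> 1 r) powr (- \<rho>) \<le> Re (U r)" if "r \<ge> 0" for r
    using Re_hankel_ray_powr_ge[OF that, of "- \<rho>"] assms by (simp add: U_def b_def)
  have U_pos: "0 < Re (U r)" if "r \<ge> 0" for r
    using U_ge[OF that] b norm_pos[of r] by (auto intro!: less_le_trans[OF _ U_ge[OF that]])
  obtain C where C: "0 \<le> C" "\<And>r. 0 \<le> r \<Longrightarrow> norm (hankel_ray \<theta> 1 r) powr \<rho> \<le> C * (1 + r) powr \<bar>\<rho>\<bar>"
    using norm_hankel_ray_powr_le[of 1] by (metis zero_less_one)
  define K where "K = \<bar>z\<bar> / b * C"
  have K: "K \<ge> 0" using C b by (simp add: K_def)
  \<comment> \<open>The sector bound makes \<open>1 / Re (U r)\<close> at most a multiple of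
    \<open>norm (hankel_ray \<theta> 1 r) powr \<rho>\<close>, so its growth exponent is at most
    \<open>\<bar>\<rho>\<bar> < 1\<close>.\<close>
  have exp_le: "exp (\<bar>z\<bar> / Re (U r)) \<le> exp (K * (1 + r) powr \<bar>\<rho>\<bar>)" if "r \<ge> 0" for r
  proof -
    have "\<bar>z\<bar> / Re (U r) \<le> \<bar>z\<bar> / (b * norm (hankel_ray \<theta> 1 r) powr (- \<rho>))"
      using U_ge[OF that] b norm_pos[of r] U_pos[OF that] by (intro divide_left_mono) auto
    also have "\<dots> = \<bar>z\<bar> / b * norm (hankel_ray \<theta> 1 r) powr \<rho>"
      using norm_pos[of r] by (simp add: powr_minus field_simps)
    also have "\<dots> \<le> \<bar>z\<bar> / b * (C * (1 + r) powr \<bar>\<rho>\<bar>)"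
      using C(2)[OF that] b by (intro mult_left_mono) auto
    finally show ?thesis by (simp add: K_def mult_ac)
  qed
  have inner: "has_bochner_integral lborel (f r) ((indicator {0..} r *\<^sub>R E r) * (exp (of_real z / U r) - 1))" for r
  proof (cases "r \<ge> 0")
    case True
    thus ?thesis unfolding f_def
      by (intro has_bochner_integral_mult_right has_bochner_integral_bessel_kernel U_pos)
  qed (simp add: f_def[abs_def] has_bochner_integral_zero)
  have int2: "integrable lborel (f r)" for r
    using inner by (rule integrable.intros)
  have norm_inner: "(LINT s|lborel. norm (f r s)) \<le>
    indicator {0..} r * (exp (1 + r * cos \<theta>) * exp (K * (1 + r) powr \<bar>\<rho>\<bar>))" for r
  proof (cases "r \<ge> 0")
    case True
    have B: "has_bochner_integral lborel
       (\<lambda>s. indicator {0<..} s *\<^sub>R (exp (- (Re (U r) * s)) * bessel_kernel \<bar>z\<bar> s)) (exp (\<bar>z\<bar> / Re (U r)) - 1)"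
    proof -
      have exp_Re: "exp (- (complex_of_real (Re (U r)) * of_real s)) = of_real (exp (- (Re (U r) * s)))" for s
        by (subst exp_of_real[symmetric]) simp
      have exp_z: "exp (complex_of_real \<bar>z\<bar> / of_real (Re (U r))) = of_real (exp (\<bar>z\<bar> / Re (U r)))"
        by (subst exp_of_real[symmetric]) simp
      have "0 < Re (complex_of_real (Re (U r)))" using U_pos[OF True] by simp
      from has_bochner_integral_bessel_kernel[OF this, of "\<bar>z\<bar>"]
      have "has_bochner_integral lborel (\<lambda>s. complex_of_real
        (indicator {0<..} s *\<^sub>R (exp (- (Re (U r) * s)) * bessel_kernel \<bar>z\<bar> s))) (of_real (exp (\<bar>z\<bar> / Re (U r)) - 1))"
        unfolding exp_Re exp_z by (simp add: scaleR_conv_of_real)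
      from has_bochner_integral_Re[OF this] show ?thesis by simp
    qed
    have "(LINT s|lborel. norm (f r s)) \<le> (LINT s|lborel. exp (1 + r * cos \<theta>) *
       (indicator {0<..} s *\<^sub>R (exp (- (Re (U r) * s)) * bessel_kernel \<bar>z\<bar> s)))"
    proof (rule integral_mono)
      show "integrable lborel (\<lambda>s. norm (f r s))" using int2 by (rule integrable_norm)
      show "integrable lborel (\<lambda>s. exp (1 + r * cos \<theta>) *
       (indicator {0<..} s *\<^sub>R (exp (- (Re (U r) * s)) * bessel_kernel \<bar>z\<bar> s)))"
        using B by (intro integrable_mult_right) (rule integrable.intros)
      fix s
      show "norm (f r s) \<le> exp (1 + r * cos \<theta>) *
        (indicator {0<..} s *\<^sub>R (exp (- (Re (U r) * s)) * bessel_kernel \<bar>z\<bar> s))"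
        using True abs_bessel_kernel_le[of s z]
        unfolding f_def E_def norm_mult norm_scaleR norm_exp_hankel_ray norm_of_real
        by (cases "s > 0") (simp_all add: mult_left_mono)
    qed
    also have "\<dots> = exp (1 + r * cos \<theta>) * (exp (\<bar>z\<bar> / Re (U r)) - 1)"
      using B by (intro has_bochner_integral_integral_eq has_bochner_integral_mult_right)
    also have "\<dots> \<le> exp (1 + r * cos \<theta>) * exp (K * (1 + r) powr \<bar>\<rho>\<bar>)"
    proof (rule mult_left_mono)
      show "exp (\<bar>z\<bar> / Re (U r)) - 1 \<le> exp (K * (1 + r) powr \<bar>\<rho>\<bar>)"
        using exp_le[OF True] by linarith
    qed simp
    finally show ?thesis using True by simp
  qed (simp add: f_def)
  have pair_int: "integrable (lborel \<Otimes>\<^sub>M lborel) (\<lambda>(r, s). f r s)"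
  proof (rule lborel_pair.Fubini_integrable)
    show meas: "(\<lambda>(r, s). f r s) \<in> borel_measurable (lborel \<Otimes>\<^sub>M lborel)"
      unfolding f_def by measurable
    have "integrable lborel (\<lambda>r. indicator {0..} r * (exp (1 + r * cos \<theta>) * exp (K * (1 + r) powr \<bar>\<rho>\<bar>)))"
      using K assms by (intro integrable_hankel_dominator) auto
    moreover have "(\<lambda>r. LINT s|lborel. norm (case (r, s) of (r, s) \<Rightarrow> f r s)) \<in> borel_measurable lborel"
      using meas by measurable
    ultimately show "integrable lborel (\<lambda>r. LINT s|lborel. norm (case (r, s) of (r, s) \<Rightarrow> f r s))"
    proof (rule Bochner_Integration.integrable_bound)
      have "norm (LINT s|lborel. norm (f r s)) \<le>
        norm (indicator {0..} r * (exp (1 + r * cos \<theta>) * exp (K * (1 + r) powr \<bar>\<rho>\<bar>)))" for r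
        using norm_inner[of r] Bochner_Integration.integral_nonneg[of lborel "\<lambda>s. norm (f r s)"] by simp
      thus "AE r in lborel. norm (LINT s|lborel. norm (case (r, s) of (r, s) \<Rightarrow> f r s)) \<le>
        norm (indicator {0..} r * (exp (1 + r * cos \<theta>) * exp (K * (1 + r) powr \<bar>\<rho>\<bar>)))"
        by simp
    qed
    show "AE r in lborel. integrable lborel (\<lambda>s. case (r, s) of (r, s) \<Rightarrow> f r s)"
      using int2 by simp
  qed
  have outer: "Im (LINT r|lborel. f r s) / pi = indicator {0<..} s *\<^sub>R (reduced_wright \<rho> (- s) * bessel_kernel z s)" for s
  proof -
    have "(LINT r|lborel. f r s) = (LINT r|lborel. (indicator {0..} r *\<^sub>R (E r * exp (of_real (- s) * U r))) *
       of_real (indicator {0<..} s * bessel_kernel z s))"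
      by (intro Bochner_Integration.integral_cong) (auto simp: f_def scaleR_conv_of_real mult_ac)
    also have "\<dots> = (LINT r:{0..}|lborel. E r * exp (of_real (- s) * U r)) * of_real (indicator {0<..} s * bessel_kernel z s)"
      unfolding set_lebesgue_integral_def by (rule integral_mult_left_zero)
    finally have "Im (LINT r|lborel. f r s) / pi = hankel_functional (\<lambda>u. exp (of_real (- s) * u powr of_real (- \<rho>))) *
      (indicator {0<..} s * bessel_kernel z s)"
      by (simp add: hankel_functional_def E_def U_def)
    thus ?thesis
      unfolding reduced_wright_eq_hankel_functional[OF assms(1)] by (simp add: mult_ac)
  qed
  have "(LINT s|lborel. LINT r|lborel. f r s) = (LINT r|lborel. LINT s|lborel. f r s)"
    by (rule lborel_pair.Fubini_integral[OF pair_int])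
  also have "\<dots> = (LINT r|lborel. (indicator {0..} r *\<^sub>R E r) * (exp (of_real z / U r) - 1))"
    using inner by (intro Bochner_Integration.integral_cong) (auto intro: has_bochner_integral_integral_eq)
  \<comment> \<open>Since \<open>1 / U r\<close> is the power with exponent \<open>\<rho>\<close>,
    the first part is the contour integral for \<open>- \<rho>\<close>. Writing the \<open>1\<close>
    as the exponential at \<open>z = 0\<close> makes the second part one too, with value
    \<open>reduced_wright (- \<rho>) 0 = 0\<close>.\<close>
  also have "\<dots> = (LINT r|lborel. indicator {0..} r *\<^sub>R (E r * exp (of_real z * hankel_ray \<theta> 1 r powr of_real (- (- \<rho>)))) -
      indicator {0..} r *\<^sub>R (E r * exp (of_real 0 * hankel_ray \<theta> 1 r powr of_real (- (- \<rho>)))))"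
    by (intro Bochner_Integration.integral_cong refl) (simp add: U_def powr_minus divide_inverse algebra_simps)
  also have "\<dots> = (LINT r:{0..}|lborel. E r * exp (of_real z * hankel_ray \<theta> 1 r powr of_real (- (- \<rho>)))) -
      (LINT r:{0..}|lborel. E r * exp (of_real 0 * hankel_ray \<theta> 1 r powr of_real (- (- \<rho>))))"
  proof -
    have "\<bar>- \<rho>\<bar> < 1" using assms by simp
    note int = set_integrable_hankel_exp[OF this]
    show ?thesis
      using int[of z] int[of 0] unfolding set_lebesgue_integral_def set_integrable_def E_def
      by (intro Bochner_Integration.integral_diff)
  qed
  finally have "Im (LINT s|lborel. LINT r|lborel. f r s) / pi = reduced_wright (- \<rho>) z - reduced_wright (- \<rho>) 0"
    using assms
    by (simp add: reduced_wright_eq_hankel_functional[of "- \<rho>"] hankel_functional_def E_def diff_divide_distrib)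
  moreover have "reduced_wright (- \<rho>) 0 = 0" by (simp add: reduced_wright_def)
  moreover have "has_bochner_integral lborel (\<lambda>s. Im (LINT r|lborel. f r s) / pi) (Im (LINT s|lborel. LINT r|lborel. f r s) / pi)"
    using lborel_pair.integrable_snd[OF pair_int]
    by (intro has_bochner_integral_divide_zero has_bochner_integral_Im) (simp add: has_bochner_integral_iff)
  ultimately show ?thesis by (simp add: outer)
qed

end

theorem reduced_wright_transform:
  fixes \<rho> z :: real
  assumes "\<bar>\<rho>\<bar> < 1"
  shows "has_bochner_integral lborel
    (\<lambda>s. indicator {0<..} s *\<^sub>R (reduced_wright \<rho> (- s) * bessel_kernel z s)) (reduced_wright (- \<rho>) z)"
proof -
  obtain \<theta> where "hankel_angle \<theta>" "\<bar>\<rho>\<bar> * \<theta> < pi / 2" using ex_hankel_angle[OF assms] .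
  thus ?thesis using assms by (intro hankel_angle.reduced_wright_bessel_kernel_transform)
qed

text \<open>Integrability is asserted next to each identity because the integral of a non-integrable
  function is \<open>0\<close> by convention.\<close>

theorem corollary1:
  fixes \<sigma> x :: real
  assumes "0 < \<sigma>" and "\<sigma> < 1" and "0 < x"
  shows "(set_integrable lborel {0<..}
           (\<lambda>s. reduced_wright (- \<sigma>) (- s) * s powr (- (1/2)) * bessel_I 1 (2 * sqrt (x * s))) \<and>
          reduced_wright \<sigma> x = sqrt x *
           (LBINT s:{0<..}. reduced_wright (- \<sigma>) (- s) * s powr (- (1/2)) * bessel_I 1 (2 * sqrt (x * s)))) \<and>
         (set_integrable lborel {0<..}
           (\<lambda>s. reduced_wright \<sigma> (- s) * s powr (- (1/2)) * bessel_J 1 (2 * sqrt (x * s))) \<and>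
          reduced_wright (- \<sigma>) (- x) = - (sqrt x *
           (LBINT s:{0<..}. reduced_wright \<sigma> (- s) * s powr (- (1/2)) * bessel_J 1 (2 * sqrt (x * s)))))"
proof -
  \<comment> \<open>The identities between kernel and Bessel functions hold only for
    \<open>s > 0\<close>, which the indicator enforces; a nonzero factor \<open>c\<close> carries
    integrability over.\<close>
  have transfer: "set_integrable lborel {0<..} f \<and> y = c * (LBINT s:{0<..}. f s)"
    if "has_bochner_integral lborel (\<lambda>s. indicator {0<..} s *\<^sub>R g s) y"
      and "\<And>s. 0 < s \<Longrightarrow> g s = c * f s" and "c \<noteq> 0" for f g :: "real \<Rightarrow> real" and c y
  proof -
    have "(\<lambda>s. indicator {0<..} s *\<^sub>R g s) = (\<lambda>s. c * (indicator {0<..} s *\<^sub>R f s))"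
      using that(2) by (auto simp: fun_eq_iff indicator_def)
    with that(1,3) show ?thesis
      by (simp add: has_bochner_integral_iff set_integrable_def set_lebesgue_integral_def)
  qed
  have "has_bochner_integral lborel
    (\<lambda>s. indicator {0<..} s *\<^sub>R (reduced_wright (- \<sigma>) (- s) * bessel_kernel x s)) (reduced_wright \<sigma> x)"
    using reduced_wright_transform[of "- \<sigma>" x] assms by simp
  hence I: "set_integrable lborel {0<..}
           (\<lambda>s. reduced_wright (- \<sigma>) (- s) * s powr (- (1/2)) * bessel_I 1 (2 * sqrt (x * s))) \<and>
          reduced_wright \<sigma> x = sqrt x *
           (LBINT s:{0<..}. reduced_wright (- \<sigma>) (- s) * s powr (- (1/2)) * bessel_I 1 (2 * sqrt (x * s)))"
  proof (rule transfer)
    fix s :: real assume "0 < s"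
    show "reduced_wright (- \<sigma>) (- s) * bessel_kernel x s =
      sqrt x * (reduced_wright (- \<sigma>) (- s) * s powr (- (1/2)) * bessel_I 1 (2 * sqrt (x * s)))"
      unfolding bessel_I_1_eq_bessel_kernel[OF assms(3) \<open>0 < s\<close>, symmetric] by (simp only: mult_ac)
  qed (use assms in simp)
  have "has_bochner_integral lborel
    (\<lambda>s. indicator {0<..} s *\<^sub>R (reduced_wright \<sigma> (- s) * bessel_kernel (- x) s)) (reduced_wright (- \<sigma>) (- x))"
    using reduced_wright_transform[of \<sigma> "- x"] assms by simp
  hence J: "set_integrable lborel {0<..}
           (\<lambda>s. reduced_wright \<sigma> (- s) * s powr (- (1/2)) * bessel_J 1 (2 * sqrt (x * s))) \<and>
          reduced_wright (- \<sigma>) (- x) = - sqrt x *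
           (LBINT s:{0<..}. reduced_wright \<sigma> (- s) * s powr (- (1/2)) * bessel_J 1 (2 * sqrt (x * s)))"
  proof (rule transfer)
    fix s :: real assume "0 < s"
    have "bessel_kernel (- x) s = - (sqrt x * (s powr (- (1/2)) * bessel_J 1 (2 * sqrt (x * s))))"
      using bessel_J_1_eq_bessel_kernel[OF assms(3) \<open>0 < s\<close>] by linarith
    thus "reduced_wright \<sigma> (- s) * bessel_kernel (- x) s =
      - sqrt x * (reduced_wright \<sigma> (- s) * s powr (- (1/2)) * bessel_J 1 (2 * sqrt (x * s)))"
      by (simp only: mult_minus_left mult_minus_right mult_ac)
  qed (use assms in simp)
  show ?thesis
    using I J unfolding mult_minus_left by (rule conjI)
qed

end
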